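(* Let $E$ be a complex Banach space not containing an isomorphic copy of $\mathrm{c}_0$, let $\mathcal{S}\subseteq\mathscr{L}(E)$ be a bounded, abelian operator semigroup, and let $P\in\mathscr{L}(E_{\mathrm{aap}})$ be the corresponding Jacobs--de Leeuw--Glicksberg projection. For $x\in E$ the following assertions are equivalent: (a) $\mathcal{S}x$ is relatively compact. (b) The following two conditions are satisfied: (i) $\mathcal{S}(I-T)x$ is relatively compact for every $T\in\mathcal{S}$; (ii) $(I-P)(I-\mathcal{S})x$ is relatively compact.
   Context: $\mathscr{L}(E)$ denotes the bounded linear operators on $E$ and $I$ the identity operator. An operator semigroup $\mathcal{S}\subseteq\mathscr{L}(E)$ is a nonempty set of operators closed under composition; it is abelian if its elements commute, and bounded if $\sup_{S\in\mathcal{S}}\|S\|<\infty$. Write $\mathcal{S}x=\{Sx\mid S\in\mathcal{S}\}$, $\mathcal{S}(I-T)x=\{Sx-STx\mid S\in\mathcal{S}\}$, and $(I-P)(I-\mathcal{S})x=\{(I-P)(x-Sx)\mid S\in\mathcal{S}\}$. Relative compactness is in the norm topology. Set $E_{\mathrm{aap}}=\{y\in E\mid \mathcal{S}y\text{ is relatively compact}\}$, a closed $\mathcal{S}$-invariant subspace of $E$. The restriction of $\mathcal{S}$ to $E_{\mathrm{aap}}$ is an abelian semigroup with relatively compact orbits; let $\overline{\mathcal{S}}$ be the closure of this restricted semigroup in $\mathscr{L}(E_{\mathrm{aap}})$ with respect to the strong operator topology. By the Jacobs--de Leeuw--Glicksberg theorem there is a unique projection $P\in\overline{\mathcal{S}}\subseteq\mathscr{L}(E_{\mathrm{aap}})$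 such that $\overline{\mathcal{S}}$ restricted to $E_{\mathrm{rev}}=\mathrm{rg}(P)$ is a compact topological group (for the strong operator topology) and $\overline{\mathcal{S}}$ restricted to $E_{\mathrm{aws}}=\ker(P)$ contains the zero operator. This $P$ is the Jacobs--de Leeuw--Glicksberg projection corresponding to $\mathcal{S}$. Under (i), $x-Sx\in E_{\mathrm{aap}}$ for all $S\in\mathcal{S}$, so that (ii) is meaningful. $\mathrm{c}_0$ is the Banach space of complex null sequences with the supremum norm; "$E$ contains an isomorphic copy of $\mathrm{c}_0$" means that some closed subspace of $E$ is linearly homeomorphic to $\mathrm{c}_0$. *)

theory Defs
  imports "HOL-Analysis.Analysis" "HOL-Algebra.Group"
begin

section \<open>Complex normed and Banach spaces\<close>

class complex_vector = real_vector +
  fixes scaleC :: "complex \<Rightarrow> 'a \<Rightarrow> 'a"  (infixr \<open>*\<^sub>C\<close> 75)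
  assumes scaleC_add_right: "a *\<^sub>C (x + y) = a *\<^sub>C x + a *\<^sub>C y"
    and scaleC_add_left: "(a + b) *\<^sub>C x = a *\<^sub>C x + b *\<^sub>C x"
    and scaleC_scaleC: "a *\<^sub>C b *\<^sub>C x = (a * b) *\<^sub>C x"
    and scaleC_of_real: "complex_of_real r *\<^sub>C x = r *\<^sub>R x"

class complex_normed_vector = complex_vector + real_normed_vector +
  assumes norm_scaleC: "norm (a *\<^sub>C x) = cmod a * norm x"

class complex_banach = complex_normed_vector + banach

abbreviation csubspace :: "'a::complex_vector set \<Rightarrow> bool"
  where "csubspace \<equiv> module.subspace scaleC"

definition clinear_on :: "'a::complex_vector set \<Rightarrow> ('a \<Rightarrow> 'b::complex_vector) \<Rightarrow> bool"
  where "clinear_on V f \<longleftrightarrow>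
    (\<forall>x\<in>V. \<forall>y\<in>V. f (x + y) = f x + f y) \<and> (\<forall>c. \<forall>x\<in>V. f (c *\<^sub>C x) = c *\<^sub>C f x)"

lemma module_scaleC: "module (scaleC :: complex \<Rightarrow> 'a::complex_vector \<Rightarrow> 'a)"
proof
  fix x :: 'a
  show "1 *\<^sub>C x = x"
    using scaleC_of_real[of 1 x] by simp
qed (simp_all add: scaleC_add_right scaleC_add_left scaleC_scaleC)

instantiation complex :: complex_banach
begin

definition scaleC_complex :: "complex \<Rightarrow> complex \<Rightarrow> complex"
  where "scaleC_complex a x = a * x"

instance
  by standard (simp_all add: scaleC_complex_def algebra_simps norm_mult scaleR_conv_of_real)

end

instantiation bcontfun :: (topological_space, complex_normed_vector) complex_normed_vector
begin

definition scaleC_bcontfun :: "complex \<Rightarrow> ('a \<Rightarrow>\<^sub>C 'b) \<Rightarrow> ('a \<Rightarrow>\<^sub>C 'b)"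
  where "scaleC_bcontfun a f = Bcontfun (\<lambda>t. a *\<^sub>C apply_bcontfun f t)"

lemma bounded_linear_scaleC: "bounded_linear (\<lambda>x::'b. a *\<^sub>C x)"
proof (rule bounded_linear_intro)
  fix x y :: 'b and r :: real
  show "a *\<^sub>C (x + y) = a *\<^sub>C x + a *\<^sub>C y"
    by (rule scaleC_add_right)
  show "a *\<^sub>C (r *\<^sub>R x) = r *\<^sub>R (a *\<^sub>C x)"
    by (simp add: scaleC_scaleC mult.commute flip: scaleC_of_real)
  show "norm (a *\<^sub>C x) \<le> norm x * cmod a"
    by (simp add: norm_scaleC mult.commute)
qed

lemma apply_bcontfun_scaleC:
  "apply_bcontfun (a *\<^sub>C f) t = a *\<^sub>C apply_bcontfun f t"
  for f :: "'a \<Rightarrow>\<^sub>C 'b"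
proof -
  have "(\<lambda>t. a *\<^sub>C apply_bcontfun f t) \<in> bcontfun"
  proof (rule bcontfun_normI)
    show "continuous_on UNIV (\<lambda>t. a *\<^sub>C apply_bcontfun f t)"
      by (intro bounded_linear.continuous_on[OF bounded_linear_scaleC]) simp
    show "norm (a *\<^sub>C apply_bcontfun f t) \<le> cmod a * norm f" for t
      by (simp add: norm_scaleC mult_left_mono norm_bounded)
  qed
  then show ?thesis
    by (simp add: scaleC_bcontfun_def Bcontfun_inverse)
qed

instance
proof
  fix a b :: complex and r :: real and f g :: "'a \<Rightarrow>\<^sub>C 'b"
  show "a *\<^sub>C (f + g) = a *\<^sub>C f + a *\<^sub>C g"
    by (rule bcontfun_eqI) (simp add: apply_bcontfun_scaleC scaleC_add_right)
  show "(a + b) *\<^sub>C f = a *\<^sub>C f + b *\<^sub>C f"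
    by (rule bcontfun_eqI) (simp add: apply_bcontfun_scaleC scaleC_add_left)
  show "a *\<^sub>C b *\<^sub>C f = (a * b) *\<^sub>C f"
    by (rule bcontfun_eqI) (simp add: apply_bcontfun_scaleC scaleC_scaleC)
  show r: "complex_of_real r *\<^sub>C f = r *\<^sub>R f" for r and f :: "'a \<Rightarrow>\<^sub>C 'b"
    by (rule bcontfun_eqI) (simp add: apply_bcontfun_scaleC scaleC_of_real)
  have le: "norm (c *\<^sub>C h) \<le> cmod c * norm h" for c and h :: "'a \<Rightarrow>\<^sub>C 'b"
    by (rule norm_bound) (simp add: apply_bcontfun_scaleC norm_scaleC mult_left_mono norm_bounded)
  show "norm (a *\<^sub>C f) = cmod a * norm f"
  proof (cases "a = 0")
    case True
    then show ?thesis using r[of 0 f] by simp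
  next
    case False
    have "inverse a *\<^sub>C a *\<^sub>C f = f"
      by (rule bcontfun_eqI)
        (use False scaleC_of_real[of 1] in \<open>simp add: apply_bcontfun_scaleC scaleC_scaleC\<close>)
    with le[of "inverse a" "a *\<^sub>C f"] have "norm f \<le> cmod (inverse a) * norm (a *\<^sub>C f)"
      by simp
    then have "cmod a * norm f \<le> norm (a *\<^sub>C f)"
      using False by (simp add: norm_divide norm_inverse field_simps)
    with le[of a f] show ?thesis by simp
  qed
qed

end


section \<open>Copies of the space of null sequences\<close>

text \<open>The ambient type carries the supremum norm and the coordinatewise operations, since every
  function on the discrete space \<^typ>\<open>nat\<close> is continuous.\<close>

definition c0 :: "(nat \<Rightarrow>\<^sub>C complex) set"
  where "c0 = {f. apply_bcontfun f \<longlonglongrightarrow> 0}"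

definition linearly_homeomorphic ::
    "'a::complex_normed_vector set \<Rightarrow> 'b::complex_normed_vector set \<Rightarrow> bool"
  where "linearly_homeomorphic V W \<longleftrightarrow> (\<exists>f g. homeomorphism V W f g \<and> clinear_on V f)"

definition contains_copy_of_c0 :: "'a::complex_banach itself \<Rightarrow> bool"
  where "contains_copy_of_c0 _ \<longleftrightarrow>
    (\<exists>F::'a set. csubspace F \<and> closed F \<and> linearly_homeomorphic F c0)"


section \<open>Operator semigroups\<close>

definition operator_semigroup :: "('a::complex_banach \<Rightarrow>\<^sub>L 'a) set \<Rightarrow> bool"
  where "operator_semigroup \<S> \<longleftrightarrow> \<S> \<noteq> {} \<and> (\<forall>S\<in>\<S>. clinear_on UNIV (blinfun_apply S)) \<and>
    (\<forall>S\<in>\<S>. \<forall>T\<in>\<S>. S o\<^sub>L T \<in> \<S>)"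

definition abelian :: "('a::complex_banach \<Rightarrow>\<^sub>L 'a) set \<Rightarrow> bool"
  where "abelian \<S> \<longleftrightarrow> (\<forall>S\<in>\<S>. \<forall>T\<in>\<S>. S o\<^sub>L T = T o\<^sub>L S)"

definition relatively_compact :: "'a::topological_space set \<Rightarrow> bool"
  where "relatively_compact A \<longleftrightarrow> compact (closure A)"

definition E_aap :: "('a::complex_banach \<Rightarrow>\<^sub>L 'a) set \<Rightarrow> 'a set"
  where "E_aap \<S> = {y. relatively_compact {blinfun_apply S y | S. S \<in> \<S>}}"


section \<open>Operators on subspaces and the strong operator topology\<close>

text \<open>Subspaces are sets, so an operator on a subspace \<open>V\<close> is represented by a function that
  takes the value \<^const>\<open>undefined\<close> off \<open>V\<close>; thus operators on \<open>V\<close> are equal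
  iff they agree on \<open>V\<close>, composition is \<^term>\<open>compose V\<close> and the topology of pointwise
  convergence is a product topology indexed by \<open>V\<close>.\<close>

definition bounded_ops_on :: "'a::complex_normed_vector set \<Rightarrow> ('a \<Rightarrow> 'a) set"
  where "bounded_ops_on V =
    {T \<in> V \<rightarrow>\<^sub>E V. clinear_on V T \<and> (\<exists>K. \<forall>x\<in>V. norm (T x) \<le> K * norm x)}"

definition strong_operator_topology_on :: "'a::complex_normed_vector set \<Rightarrow> ('a \<Rightarrow> 'a) topology"
  where "strong_operator_topology_on V =
    subtopology (product_topology (\<lambda>_. euclidean) V) (bounded_ops_on V)"

definition restrict_ops :: "('a \<Rightarrow> 'a) set \<Rightarrow> 'a set \<Rightarrow> ('a \<Rightarrow> 'a) set"
  where "restrict_ops \<T> V = (\<lambda>T. restrict T V) ` \<T>"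

definition ops_monoid :: "('a \<Rightarrow> 'a) set \<Rightarrow> 'a set \<Rightarrow> ('a \<Rightarrow> 'a) monoid"
  where "ops_monoid \<T> V =
    \<lparr>carrier = restrict_ops \<T> V, mult = compose V, one = (\<lambda>x\<in>V. x)\<rparr>"

definition topological_group :: "('b, 'm) monoid_scheme \<Rightarrow> 'b topology \<Rightarrow> bool"
  where "topological_group G X \<longleftrightarrow> group G \<and> topspace X = carrier G \<and>
    continuous_map (prod_topology X X) X (\<lambda>(g, h). g \<otimes>\<^bsub>G\<^esub> h) \<and>
    continuous_map X X (\<lambda>g. inv\<^bsub>G\<^esub> g)"


section \<open>The Jacobs--de Leeuw--Glicksberg projection\<close>

definition strong_closure_aap :: "('a::complex_banach \<Rightarrow>\<^sub>L 'a) set \<Rightarrow> ('a \<Rightarrow> 'a) set"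
  where "strong_closure_aap \<S> =
    strong_operator_topology_on (E_aap \<S>) closure_of
      restrict_ops (blinfun_apply ` \<S>) (E_aap \<S>)"

definition JdLG_projection :: "('a::complex_banach \<Rightarrow>\<^sub>L 'a) set \<Rightarrow> ('a \<Rightarrow> 'a) \<Rightarrow> bool"
  where "JdLG_projection \<S> P \<longleftrightarrow>
    (let E = E_aap \<S>;
         \<T> = strong_closure_aap \<S>;
         E_rev = P ` E;
         E_aws = {y \<in> E. P y = 0};
         X_rev = subtopology (strong_operator_topology_on E_rev) (restrict_ops \<T> E_rev)
     in P \<in> \<T> \<and> (\<forall>y\<in>E. P (P y) = P y) \<and>
        topological_group (ops_monoid \<T> E_rev) X_rev \<and> compact_space X_rev \<and>
        (\<lambda>y\<in>E_aws. 0) \<in> restrict_ops \<T> E_aws)"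

end

theory Submission
  imports Defs
begin

text \<open>
  Write \<open>u S = P (x - S x)\<close>. Then \<open>S x = x - u S - (I - P) (x - S x)\<close>, and condition (ii) takes care
  of the last term, so everything rests on the relative compactness of the values of \<open>u\<close>. They
  lie in the reversible part \<open>E_rev\<close> and satisfy the cocycle identity \<open>u (R S) = u R + R (u S)\<close>,
  because \<open>P\<close> commutes with the semigroup.

  On \<open>E_rev\<close> the closure of the semigroup is a group, hence every \<open>S\<close> can be undone approximately,
  on finitely many vectors, by an element of the semigroup (\<open>recurrence\<close>). Orbits in \<open>E_rev\<close> are
  relatively compact, so if \<open>u\<close> did not have totally bounded range, pigeonhole would yield operators
  \<open>R\<close> with \<open>u R\<close> bounded away from zero that almost fix any given finite set of earlier values.
  For a sequence of such operators, with rapidly decreasing errors, the cocycle identity says that the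
  sum of the \<open>u R\<close> over a finite set is almost the value of \<open>u\<close> at the product of these
  \<open>R\<close>. As \<open>u\<close> is bounded, the finite subset sums are bounded although the terms stay away from
  zero (\<open>contains_copy_of_c0_if_almost_additive\<close>).

  By a theorem of Bessaga and Pelczynski such a sequence exists only in spaces that contain
  \<open>c0\<close>. Boundedness of the subset sums gives the upper estimate against the supremum norm. For the lower
  one, take functionals norming the terms, and pass to a subsequence with Rosenthal's lemma so that each
  functional nearly ignores all terms but its own; the functionals come from a Hahn--Banach argument
  with minimal sublinear functionals.

  For the converse implication, all sets involved are continuous images of subsets of compact ones.
\<close>

section \<open>Norming functionals\<close>

text \<open>The norming functional comes from Zorn's lemma applied to the sublinear functionals below
  the norm, ordered pointwise: a minimal one is odd, hence linear.\<close>

definition sublinear :: "('a::real_vector \<Rightarrow> real) \<Rightarrow> bool"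
  where "sublinear q \<longleftrightarrow> q 0 = 0 \<and> (\<forall>x y. q (x + y) \<le> q x + q y) \<and>
    (\<forall>c>0. \<forall>x. q (c *\<^sub>R x) \<le> c * q x)"

lemma sublinear_minus_le:
  assumes "sublinear q"
  shows "- q (- x) \<le> q x"
proof -
  have "q (x + - x) \<le> q x + q (- x)" "q 0 = 0"
    using assms unfolding sublinear_def by blast+
  then show ?thesis by simp
qed

text \<open>\<open>tilt q y\<close> is the largest sublinear functional below \<open>q\<close> whose value at \<open>- y\<close> is at most
  \<open>- q y\<close>. If \<open>q\<close> is minimal it equals all its tilts, which is oddness of \<open>q\<close>.\<close>

definition tilt :: "('a::real_vector \<Rightarrow> real) \<Rightarrow> 'a \<Rightarrow> 'a \<Rightarrow> real"
  where "tilt q y x = (INF t\<in>{0..}. q (x + t *\<^sub>R y) - t * q y)"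

lemma tilt_bdd_below:
  assumes "sublinear q"
  shows "bdd_below ((\<lambda>t. q (x + t *\<^sub>R y) - t * q y) ` {0..})"
proof (rule bdd_belowI2)
  fix t :: real assume "t \<in> {0..}"
  then consider "t = 0" | "t > 0" by force
  then show "- q (- x) \<le> q (x + t *\<^sub>R y) - t * q y"
  proof cases
    case 1
    then show ?thesis using sublinear_minus_le[OF assms, of x] by simp
  next
    case 2
    have "q ((1 / t) *\<^sub>R (t *\<^sub>R y)) \<le> (1 / t) * q (t *\<^sub>R y)"
      using assms 2 unfolding sublinear_def by (meson divide_pos_pos zero_less_one)
    then have "t * q y \<le> q (t *\<^sub>R y)"
      using 2 by (simp add: field_simps)
    moreover have "q ((x + t *\<^sub>R y) + - x) \<le> q (x + t *\<^sub>R y) + q (- x)"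
      using assms unfolding sublinear_def by blast
    ultimately show ?thesis by simp
  qed
qed

lemma tilt_le:
  assumes "sublinear q" and "t \<ge> 0"
  shows "tilt q y x \<le> q (x + t *\<^sub>R y) - t * q y"
  unfolding tilt_def by (rule cINF_lower[OF tilt_bdd_below[OF assms(1)]]) (use assms in simp)

lemma tilt_greatest:
  assumes "\<And>t. t \<ge> 0 \<Longrightarrow> b \<le> q (x + t *\<^sub>R y) - t * q y"
  shows "b \<le> tilt q y x"
  unfolding tilt_def by (rule cINF_greatest) (use assms in auto)

lemma sublinear_tilt:
  assumes q: "sublinear q"
  shows "sublinear (tilt q y)"
  unfolding sublinear_def
proof (intro conjI allI impI)
  have sub: "q (a + b) \<le> q a + q b" and hom: "c > 0 \<Longrightarrow> q (c *\<^sub>R a) \<le> c * q a" for a b c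
    using q by (auto simp: sublinear_def)
  show add: "tilt q y (a + b) \<le> tilt q y a + tilt q y b" for a b
  proof -
    have "tilt q y (a + b) - (q (b + t *\<^sub>R y) - t * q y) \<le> q (a + s *\<^sub>R y) - s * q y"
      if "s \<ge> 0" "t \<ge> 0" for s t
      using tilt_le[OF q, of "s + t" y "a + b"] that sub[of "a + s *\<^sub>R y" "b + t *\<^sub>R y"]
      by (simp add: algebra_simps)
    then have "tilt q y (a + b) - (q (b + t *\<^sub>R y) - t * q y) \<le> tilt q y a" if "t \<ge> 0" for t
      using that by (intro tilt_greatest) auto
    then have "tilt q y (a + b) - tilt q y a \<le> tilt q y b"
      by (intro tilt_greatest) (auto simp: algebra_simps)
    then show ?thesis by simp
  qed
  show hom': "tilt q y (c *\<^sub>R a) \<le> c * tilt q y a" if "c > 0" for c a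
  proof -
    have "tilt q y (c *\<^sub>R a) / c \<le> tilt q y a"
    proof (rule tilt_greatest)
      fix t :: real assume "t \<ge> 0"
      then have "tilt q y (c *\<^sub>R a) \<le> q (c *\<^sub>R (a + t *\<^sub>R y)) - (c * t) * q y"
        using tilt_le[OF q, of "c * t" y "c *\<^sub>R a"] that by (simp add: scaleR_add_right)
      also have "\<dots> \<le> c * (q (a + t *\<^sub>R y) - t * q y)"
        using hom[OF that, of "a + t *\<^sub>R y"] by (simp add: algebra_simps)
      finally show "tilt q y (c *\<^sub>R a) / c \<le> q (a + t *\<^sub>R y) - t * q y"
        using that by (simp add: field_simps)
    qed
    then show ?thesis using that by (simp add: field_simps)
  qed
  have "tilt q y 0 \<le> 0"
    using tilt_le[OF q, of 0 y 0] q by (simp add: sublinear_def)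
  moreover have "tilt q y 0 \<ge> 0"
    using hom'[of 2 0] by simp
  ultimately show "tilt q y 0 = 0" by simp
qed

lemma tilt_le_self: "sublinear q \<Longrightarrow> tilt q y x \<le> q x"
  using tilt_le[of q 0 y x] by simp

lemma tilt_uminus_le:
  assumes "sublinear q"
  shows "tilt q y (- y) \<le> - q y"
  using tilt_le[OF assms, of 1 y "- y"] assms by (simp add: sublinear_def)

lemma linear_if_sublinear_odd:
  assumes q: "sublinear q" and odd: "\<And>x. q (- x) = - q x"
  shows "linear q"
proof
  have sub: "q (a + b) \<le> q a + q b" and hom: "c > 0 \<Longrightarrow> q (c *\<^sub>R a) \<le> c * q a" for a b c
    using q by (auto simp: sublinear_def)
  show "q (a + b) = q a + q b" for a b
    using sub[of a b] sub[of "- a" "- b"] odd[of a] odd[of b] odd[of "a + b"]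
    by (simp add: algebra_simps)
  have pos: "q (c *\<^sub>R a) = c * q a" if "c > 0" for c a
    using hom[OF that, of a] hom[OF that, of "- a"] odd[of a] odd[of "c *\<^sub>R a"] by simp
  show "q (c *\<^sub>R a) = c *\<^sub>R q a" for c a
  proof (cases c "0 :: real" rule: linorder_cases)
    case less
    then show ?thesis using pos[of "- c" a] odd[of "c *\<^sub>R a"] by simp
  next
    case equal
    then show ?thesis using q by (simp add: sublinear_def)
  qed (use pos in simp)
qed

text \<open>The condition \<open>q (- z) \<le> - norm z\<close> is satisfied by \<open>tilt norm z\<close> and inherited by infima of
  chains and by tilts. Once the minimal functional is known to be odd, it says that the functional
  is norming at \<open>z\<close>.\<close>

lemma exists_norming_functional:
  fixes z :: "'a::real_normed_vector"
  obtains f :: "'a \<Rightarrow> real"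
  where "linear f" and "\<And>x. \<bar>f x\<bar> \<le> norm x" and "f z = norm z"
proof -
  define A where "A = {q :: 'a \<Rightarrow> real. sublinear q \<and> (\<forall>x. q x \<le> norm x) \<and> q (- z) \<le> - norm z}"
  have norm: "sublinear (norm :: 'a \<Rightarrow> real)"
    by (auto simp: sublinear_def norm_triangle_ineq)
  have lower: "- norm x \<le> q x" if "q \<in> A" for q x
    using that sublinear_minus_le[of q x] by (auto simp: A_def) (metis dual_order.trans neg_le_iff_le norm_minus_cancel)
  have tilt_in: "tilt q y \<in> A" if "q \<in> A" for q y
    using that sublinear_tilt[of q y] tilt_le_self[of q y] by (auto simp: A_def intro: order_trans)
  have "tilt norm z \<in> A"
    using sublinear_tilt[OF norm] tilt_le_self[OF norm] tilt_uminus_le[OF norm] by (auto simp: A_def)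
  have "\<exists>m\<in>A. \<forall>q\<in>A. q \<le> m \<longrightarrow> q = m"
  proof (rule predicate_Zorn)
    show "partial_order_on A (relation_of (\<lambda>q r. r \<le> q) A)"
      by (rule partial_order_on_relation_ofI) auto
  next
    fix C assume "C \<in> Chains (relation_of (\<lambda>q r. r \<le> q) A)"
    then have CA: "C \<subseteq> A" and chain: "\<And>q r. q \<in> C \<Longrightarrow> r \<in> C \<Longrightarrow> q \<le> r \<or> r \<le> q"
      by (auto simp: Chains_def relation_of_def)
    show "\<exists>u\<in>A. \<forall>q\<in>C. u \<le> q"
    proof (cases "C = {}")
      case True
      then show ?thesis using \<open>tilt norm z \<in> A\<close> by blast
    next
      case False
      define m where "m x = (INF q\<in>C. q x)" for x
      have subC: "q (x + y) \<le> q x + q y" "c > 0 \<Longrightarrow> q (c *\<^sub>R x) \<le> c * q x" "q 0 = 0"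
        if "q \<in> C" for q x y c
        using that CA unfolding A_def sublinear_def by blast+
      have le: "m x \<le> q x" if "q \<in> C" for q x
        unfolding m_def
        by (rule cINF_lower[OF bdd_belowI2[of _ "- norm x"]]) (use that CA lower in auto)
      have ge: "b \<le> m x" if "\<And>q. q \<in> C \<Longrightarrow> b \<le> q x" for b x
        unfolding m_def by (rule cINF_greatest) (use False that in auto)
      have "sublinear m"
        unfolding sublinear_def
      proof (intro conjI allI impI)
        fix x y
        have "m (x + y) - r y \<le> q x" if qr: "q \<in> C" "r \<in> C" for q r
        proof -
          \<comment> \<open>Two members of the chain have a common lower bound in it, so the infimum stays subadditive.\<close>
          obtain s where s: "s \<in> C" "s \<le> q" "s \<le> r"
            using chain[OF qr] qr by blast
          then have "m (x + y) \<le> s x + s y"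
            using le[of s "x + y"] subC(1)[of s x y] by linarith
          also have "\<dots> \<le> q x + r y" using le_funD[OF s(2), of x] le_funD[OF s(3), of y] by linarith
          finally show ?thesis by simp
        qed
        then have "m (x + y) - m x \<le> r y" if "r \<in> C" for r
          using ge[of "m (x + y) - r y" x] that by force
        then have "m (x + y) - m x \<le> m y" by (rule ge)
        then show "m (x + y) \<le> m x + m y" by simp
      next
        fix c :: real and x :: 'a assume c: "c > 0"
        have "m (c *\<^sub>R x) / c \<le> m x"
        proof (rule ge)
          fix q assume "q \<in> C"
          then have "m (c *\<^sub>R x) \<le> c * q x"
            using le[of q "c *\<^sub>R x"] subC(2)[of q c x] c by linarith
          then show "m (c *\<^sub>R x) / c \<le> q x" using c by (simp add: field_simps)
        qed
        then show "m (c *\<^sub>R x) \<le> c * m x" using c by (simp add: field_simps)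
      next
        have "m 0 = (INF q\<in>C. 0)" unfolding m_def by (rule INF_cong) (use subC(3) in auto)
        then show "m 0 = 0" using False by simp
      qed
      moreover obtain q where "q \<in> C" using False by blast
      then have "q x \<le> norm x" "q (- z) \<le> - norm z" for x
        using CA by (auto simp: A_def)
      ultimately have "m \<in> A"
        using le[OF \<open>q \<in> C\<close>] unfolding A_def by (blast intro: order_trans)
      then show ?thesis using le by (auto simp: le_fun_def)
    qed
  qed
  then obtain q where q: "q \<in> A" and min: "\<And>r. r \<in> A \<Longrightarrow> r \<le> q \<Longrightarrow> r = q" by blast
  then have sub: "sublinear q" by (simp add: A_def)
  have "tilt q y = q" for y
    using min[OF tilt_in[OF q]] tilt_le_self[OF sub] by (simp add: le_fun_def)
  then have "q (- y) = - q y" for y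
    using tilt_uminus_le[OF sub, of y] sublinear_minus_le[OF sub, of "- y"] by simp
  note odd = this
  show ?thesis
  proof
    show "linear q" by (rule linear_if_sublinear_odd[OF sub odd])
    show "\<bar>q x\<bar> \<le> norm x" for x
      using lower[OF q, of x] q by (simp add: A_def abs_le_iff)
    have "q (- z) \<le> - norm z" and "q z \<le> norm z" using q by (auto simp: A_def)
    then show "q z = norm z" using odd[of z] by simp
  qed
qed

section \<open>Rosenthal's lemma\<close>

text \<open>Split the index set into infinitely many infinite blocks. Either some block has the required
  property, or every block \<open>N p\<close> contains an index \<open>k p\<close> whose row has a sum above \<open>\<epsilon>\<close> over a
  finite part \<open>D p\<close> of the rest of the block. In the second case the sets \<open>D p\<close> avoid the set of
  all \<open>k p\<close>, so passing to that set lowers the bound on the row sums by \<open>\<epsilon>\<close>. Once the bound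
  has come down to zero, the property is trivial.\<close>

lemma rosenthal_disjointification:
  fixes h :: "nat \<Rightarrow> nat \<Rightarrow> real"
  assumes bound: "\<And>n G. finite G \<Longrightarrow> sum (h n) G \<le> C"
    and "\<epsilon> > 0"
  obtains M where "infinite M"
    and "\<And>n G. n \<in> M \<Longrightarrow> finite G \<Longrightarrow> G \<subseteq> M - {n} \<Longrightarrow> sum (h n) G \<le> \<epsilon>"
proof -
  have "\<exists>M. infinite M \<and> (\<forall>n\<in>M. \<forall>G. finite G \<longrightarrow> G \<subseteq> M - {n} \<longrightarrow> sum (h n) G \<le> \<epsilon>)"
    if "infinite A" "\<And>n G. n \<in> A \<Longrightarrow> finite G \<Longrightarrow> G \<subseteq> A \<Longrightarrow> sum (h n) G \<le> real j * \<epsilon>" for j A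
    using that
  proof (induction j arbitrary: A)
    case 0
    have "sum (h n) G \<le> \<epsilon>" if "n \<in> A" "finite G" "G \<subseteq> A - {n}" for n G
      using 0(2)[of n G] that \<open>\<epsilon> > 0\<close> by fastforce
    then show ?case using 0(1) by blast
  next
    case (Suc j)
    define N where "N p = (\<lambda>i. enumerate A (prod_encode (p, i))) ` UNIV" for p
    have enum: "enumerate A i = enumerate A i' \<longleftrightarrow> i = i'" for i i'
      using Suc.prems(1) by (metis enumerate_mono nat_neq_iff)
    have N_inf: "infinite (N p)" for p
      unfolding N_def by (rule range_inj_infinite) (auto simp: inj_on_def enum prod_encode_eq)
    have N_sub: "N p \<subseteq> A" for p
      using enumerate_in_set[OF Suc.prems(1)] by (auto simp: N_def)
    have N_disj: "N p \<inter> N p' = {}" if "p \<noteq> p'" for p p'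
      using that by (auto simp: N_def enum prod_encode_eq)
    show ?case
    proof (cases "\<exists>p. \<forall>n\<in>N p. \<forall>G. finite G \<longrightarrow> G \<subseteq> N p - {n} \<longrightarrow> sum (h n) G \<le> \<epsilon>")
      case True
      then show ?thesis using N_inf by blast
    next
      case False
      then have "\<forall>p. \<exists>n G. n \<in> N p \<and> finite G \<and> G \<subseteq> N p - {n} \<and> sum (h n) G > \<epsilon>"
        by (meson not_le)
      then obtain k D where k: "\<And>p. k p \<in> N p" and D: "\<And>p. finite (D p)" "\<And>p. D p \<subseteq> N p - {k p}"
          "\<And>p. sum (h (k p)) (D p) > \<epsilon>"
        by metis
      have "inj k"
        using k N_disj by (intro injI) (metis disjoint_iff)
      show ?thesis
      proof (rule Suc.IH)
        show "infinite (range k)" using \<open>inj k\<close> by (rule range_inj_infinite)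
        fix n G assume "n \<in> range k" and G: "finite G" "G \<subseteq> range k"
        then obtain p where n: "n = k p" by blast
        have "k p' \<notin> D p" for p'
          using D(2)[of p] k[of p'] N_disj[of p p'] by (cases "p = p'") auto
        then have "G \<inter> D p = {}" using G(2) by blast
        then have "sum (h n) G + sum (h n) (D p) = sum (h n) (G \<union> D p)"
          using G D by (simp add: sum.union_disjoint)
        also have "\<dots> \<le> real (Suc j) * \<epsilon>"
        proof (rule Suc.prems(2))
          show "G \<union> D p \<subseteq> A" using G(2) D(2)[of p] k N_sub by blast
          show "n \<in> A" using n k N_sub by blast
        qed (use G D in auto)
        finally show "sum (h n) G \<le> real j * \<epsilon>"
          using D(3)[of p] n by (simp add: algebra_simps)
      qed
    qed
  qed
  note step = this
  obtain j :: nat where j: "C \<le> real j * \<epsilon>"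
    using \<open>\<epsilon> > 0\<close> real_arch_simple[of "C / \<epsilon>"] by (auto simp: field_simps)
  have "sum (h n) G \<le> real j * \<epsilon>" if "finite G" for n G
    using bound[OF that] j by (rule order_trans)
  then have "\<exists>M. infinite M \<and> (\<forall>n\<in>M. \<forall>G. finite G \<longrightarrow> G \<subseteq> M - {n} \<longrightarrow> sum (h n) G \<le> \<epsilon>)"
    by (intro step[of UNIV j]) auto
  then show ?thesis using that by metis
qed

section \<open>Subset sums and copies of the space of null sequences\<close>

lemma complex_module_simps:
  fixes x :: "'a::complex_vector"
  shows "0 *\<^sub>C x = 0" and "c *\<^sub>C (0 :: 'a) = 0"
    and "(c - d) *\<^sub>C x = c *\<^sub>C x - d *\<^sub>C x"
proof -
  interpret module "scaleC :: complex \<Rightarrow> 'a \<Rightarrow> 'a" by (rule module_scaleC)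
  show "0 *\<^sub>C x = 0" and "c *\<^sub>C (0 :: 'a) = 0"
    and "(c - d) *\<^sub>C x = c *\<^sub>C x - d *\<^sub>C x"
    by (simp_all add: scale_left_diff_distrib)
qed

lemma scaleC_sum_right: "c *\<^sub>C (\<Sum>k\<in>G. y k) = (\<Sum>k\<in>G. c *\<^sub>C y k)"
  by (induction G rule: infinite_finite_induct) (simp_all add: complex_module_simps scaleC_add_right)

text \<open>A real-linear functional handles complex coefficients through this splitting, at the price of
  looking at \<open>x\<close> and \<open>\<i> x\<close> simultaneously.\<close>

lemma scaleC_conv_Re_Im: "c *\<^sub>C x = Re c *\<^sub>R x + Im c *\<^sub>R (\<i> *\<^sub>C x)"
proof -
  have "c *\<^sub>C x = (complex_of_real (Re c) + complex_of_real (Im c) * \<i>) *\<^sub>C x"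
    by (subst complex_eq) (simp add: mult.commute)
  then show ?thesis
    by (simp only: scaleC_add_left scaleC_scaleC[symmetric] scaleC_of_real)
qed

text \<open>Grouping the terms by sign turns the sum of absolute values into a difference of two values of
  \<open>f\<close> at subset sums.\<close>

lemma sum_abs_functional_le:
  fixes x :: "nat \<Rightarrow> 'a::real_normed_vector"
  assumes f: "linear f" "\<And>z. \<bar>f z\<bar> \<le> norm z"
    and B: "\<And>G. finite G \<Longrightarrow> norm (\<Sum>k\<in>G. x k) \<le> B"
    and G: "finite G"
  shows "(\<Sum>k\<in>G. \<bar>f (x k)\<bar>) \<le> 2 * B"
proof -
  let ?P = "{k \<in> G. f (x k) \<ge> 0}"
  have *: "\<bar>\<Sum>k\<in>H. f (x k)\<bar> \<le> B" if "finite H" for H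
    using f(2)[of "\<Sum>k\<in>H. x k"] B[OF that] by (simp add: linear_sum[OF f(1)])
  have "(\<Sum>k\<in>G. \<bar>f (x k)\<bar>) = (\<Sum>k\<in>?P. \<bar>f (x k)\<bar>) + (\<Sum>k\<in>G - ?P. \<bar>f (x k)\<bar>)"
    using G sum.subset_diff[of ?P G "\<lambda>k. \<bar>f (x k)\<bar>"] by (simp only: Collect_subset add.commute)
  also have "\<dots> = (\<Sum>k\<in>?P. f (x k)) - (\<Sum>k\<in>G - ?P. f (x k))"
    unfolding diff_conv_add_uminus sum_negf[symmetric] by (intro arg_cong2[of _ _ _ _ "(+)"] sum.cong) auto
  also have "\<dots> \<le> 2 * B"
    using *[of ?P] *[of "G - ?P"] G by simp
  finally show ?thesis .
qed

lemma sum_abs_functional_Re_Im_le: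
  fixes x :: "nat \<Rightarrow> 'a::complex_normed_vector"
  assumes f: "linear f" "\<And>z. \<bar>f z\<bar> \<le> norm z"
    and B: "\<And>G. finite G \<Longrightarrow> norm (\<Sum>k\<in>G. x k) \<le> B"
    and G: "finite G"
  shows "(\<Sum>k\<in>G. \<bar>f (x k)\<bar> + \<bar>f (\<i> *\<^sub>C x k)\<bar>) \<le> 4 * B"
proof -
  have "norm (\<Sum>k\<in>G. \<i> *\<^sub>C x k) \<le> B" if "finite G" for G
    using B[OF that] by (simp add: scaleC_sum_right[symmetric] norm_scaleC)
  then have "(\<Sum>k\<in>G. \<bar>f (\<i> *\<^sub>C x k)\<bar>) \<le> 2 * B"
    by (rule sum_abs_functional_le[OF f _ G])
  with sum_abs_functional_le[OF f B G] show ?thesis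
    by (simp add: sum.distrib)
qed

lemma abs_functional_scaleC_le:
  assumes "linear f"
  shows "\<bar>f (c *\<^sub>C x)\<bar> \<le> cmod c * (\<bar>f x\<bar> + \<bar>f (\<i> *\<^sub>C x)\<bar>)"
proof -
  have "f (c *\<^sub>C x) = Re c * f x + Im c * f (\<i> *\<^sub>C x)"
    by (subst scaleC_conv_Re_Im) (simp add: linear_add[OF assms] linear_scale[OF assms])
  also have "\<bar>\<dots>\<bar> \<le> \<bar>Re c\<bar> * \<bar>f x\<bar> + \<bar>Im c\<bar> * \<bar>f (\<i> *\<^sub>C x)\<bar>"
    by (metis abs_mult abs_triangle_ineq)
  also have "\<dots> \<le> cmod c * \<bar>f x\<bar> + cmod c * \<bar>f (\<i> *\<^sub>C x)\<bar>"
    by (intro add_mono mult_right_mono abs_Re_le_cmod abs_Im_le_cmod) auto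
  finally show ?thesis by (simp add: distrib_left)
qed

text \<open>Bounded subset sums make the sequence dominated by the unit vector basis of \<open>c0\<close>: test the
  combination against a norming functional.\<close>

lemma norm_sum_scaleC_le:
  fixes x :: "nat \<Rightarrow> 'a::complex_normed_vector"
  assumes B: "\<And>G. finite G \<Longrightarrow> norm (\<Sum>k\<in>G. x k) \<le> B"
    and G: "finite G" and a: "\<And>k. k \<in> G \<Longrightarrow> cmod (a k) \<le> m" and m: "m \<ge> 0"
  shows "norm (\<Sum>k\<in>G. a k *\<^sub>C x k) \<le> 4 * B * m"
proof -
  obtain f where f: "linear f" "\<And>z. \<bar>f z\<bar> \<le> norm z"
      "f (\<Sum>k\<in>G. a k *\<^sub>C x k) = norm (\<Sum>k\<in>G. a k *\<^sub>C x k)"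
    using exists_norming_functional[of "\<Sum>k\<in>G. a k *\<^sub>C x k"] by metis
  have "norm (\<Sum>k\<in>G. a k *\<^sub>C x k) = (\<Sum>k\<in>G. f (a k *\<^sub>C x k))"
    using f(3) by (simp add: linear_sum[OF f(1)])
  also have "\<dots> \<le> (\<Sum>k\<in>G. m * (\<bar>f (x k)\<bar> + \<bar>f (\<i> *\<^sub>C x k)\<bar>))"
  proof (rule sum_mono)
    fix k assume "k \<in> G"
    have "f (a k *\<^sub>C x k) \<le> cmod (a k) * (\<bar>f (x k)\<bar> + \<bar>f (\<i> *\<^sub>C x k)\<bar>)"
      using abs_functional_scaleC_le[OF f(1), of "a k" "x k"] by linarith
    also have "\<dots> \<le> m * (\<bar>f (x k)\<bar> + \<bar>f (\<i> *\<^sub>C x k)\<bar>)"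
      using a[OF \<open>k \<in> G\<close>] by (intro mult_right_mono) auto
    finally show "f (a k *\<^sub>C x k) \<le> m * (\<bar>f (x k)\<bar> + \<bar>f (\<i> *\<^sub>C x k)\<bar>)" .
  qed
  also have "\<dots> = m * (\<Sum>k\<in>G. \<bar>f (x k)\<bar> + \<bar>f (\<i> *\<^sub>C x k)\<bar>)"
    by (simp add: sum_distrib_left)
  also have "\<dots> \<le> m * (4 * B)"
    by (intro mult_left_mono sum_abs_functional_Re_Im_le f B G m)
  finally show ?thesis by (simp add: mult.commute)
qed

text \<open>Take norming functionals \<open>f n\<close> for the vectors \<open>x n\<close>. Their values on the other vectors have
  uniformly bounded absolute sums, so Rosenthal's lemma provides a subsequence on which these
  off-diagonal sums are at most \<open>\<delta> / 2\<close>. Evaluating \<open>f n\<close> at a combination whose largest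
  coefficient sits at \<open>n\<close>, the diagonal term wins.\<close>

lemma exists_subsequence_c0_lower_bound:
  fixes x :: "nat \<Rightarrow> 'a::complex_normed_vector"
  assumes B: "\<And>G. finite G \<Longrightarrow> norm (\<Sum>k\<in>G. x k) \<le> B"
    and \<delta>: "\<And>n. \<delta> \<le> norm (x n)" "\<delta> > 0"
  obtains M where "infinite M"
    and "\<And>a G n. finite G \<Longrightarrow> G \<subseteq> M \<Longrightarrow> n \<in> G \<Longrightarrow>
      \<delta> / 2 * cmod (a n) \<le> norm (\<Sum>k\<in>G. a k *\<^sub>C x k)"
proof -
  have "\<forall>n. \<exists>f. linear f \<and> (\<forall>z. \<bar>f z\<bar> \<le> norm z) \<and> f (x n) = norm (x n)"
    by (metis exists_norming_functional)
  then obtain f where f: "\<And>n. linear (f n)" "\<And>n z. \<bar>f n z\<bar> \<le> norm z"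
      "\<And>n. f n (x n) = norm (x n)" by metis
  define h where "h n k = \<bar>f n (x k)\<bar> + \<bar>f n (\<i> *\<^sub>C x k)\<bar>" for n k
  have "sum (h n) G \<le> 4 * B" if "finite G" for n G
    unfolding h_def by (rule sum_abs_functional_Re_Im_le[OF f(1,2) B that])
  then obtain M where M: "infinite M"
      "\<And>n G. n \<in> M \<Longrightarrow> finite G \<Longrightarrow> G \<subseteq> M - {n} \<Longrightarrow> sum (h n) G \<le> \<delta> / 2"
    using rosenthal_disjointification[of h "4 * B" "\<delta> / 2"] \<delta>(2) by (metis half_gt_zero)
  have max: "\<delta> / 2 * cmod (a n) \<le> norm (\<Sum>k\<in>G. a k *\<^sub>C x k)"
    if G: "finite G" "G \<subseteq> M" and n: "n \<in> G" and max: "\<And>k. k \<in> G \<Longrightarrow> cmod (a k) \<le> cmod (a n)"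
    for a G n
  proof -
    \<comment> \<open>Rotating the combination makes the dominant coefficient real, which the real functional
      needs to see its full size.\<close>
    define u where "u = (if a n = 0 then 1 else complex_of_real (cmod (a n)) / a n)"
    have u: "cmod u = 1" "u * a n = complex_of_real (cmod (a n))"
      by (auto simp: u_def norm_divide)
    have "(\<Sum>k\<in>G - {n}. \<bar>f n ((u * a k) *\<^sub>C x k)\<bar>) \<le> (\<Sum>k\<in>G - {n}. cmod (a n) * h n k)"
    proof (rule sum_mono)
      fix k assume k: "k \<in> G - {n}"
      have "\<bar>f n ((u * a k) *\<^sub>C x k)\<bar> \<le> cmod (u * a k) * h n k"
        unfolding h_def by (rule abs_functional_scaleC_le[OF f(1)])
      also have "\<dots> \<le> cmod (a n) * h n k"
        using k max by (intro mult_right_mono) (auto simp: norm_mult u h_def)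
      finally show "\<bar>f n ((u * a k) *\<^sub>C x k)\<bar> \<le> cmod (a n) * h n k" .
    qed
    also have "\<dots> = cmod (a n) * sum (h n) (G - {n})" by (simp add: sum_distrib_left)
    also have "\<dots> \<le> cmod (a n) * (\<delta> / 2)"
      using G n by (intro mult_left_mono M(2)) auto
    finally have rest: "\<bar>\<Sum>k\<in>G - {n}. f n ((u * a k) *\<^sub>C x k)\<bar> \<le> cmod (a n) * (\<delta> / 2)"
      by (rule order_trans[OF sum_abs])
    have "f n ((u * a n) *\<^sub>C x n) = cmod (a n) * norm (x n)"
      unfolding u(2) scaleC_of_real by (simp add: linear_scale[OF f(1)] f(3))
    then have "cmod (a n) * \<delta> \<le> f n ((u * a n) *\<^sub>C x n)"
      using \<delta>(1)[of n] by (simp add: mult_left_mono)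
    with rest have "cmod (a n) * (\<delta> / 2) \<le>
        f n ((u * a n) *\<^sub>C x n) + (\<Sum>k\<in>G - {n}. f n ((u * a k) *\<^sub>C x k))"
      by (simp add: abs_le_iff)
    also have "\<dots> = f n (\<Sum>k\<in>G. (u * a k) *\<^sub>C x k)"
      using sum.remove[OF G(1) n, of "\<lambda>k. f n ((u * a k) *\<^sub>C x k)"] by (simp add: linear_sum[OF f(1)])
    also have "\<dots> \<le> norm (\<Sum>k\<in>G. (u * a k) *\<^sub>C x k)"
      using f(2) abs_le_D1 by blast
    also have "(\<Sum>k\<in>G. (u * a k) *\<^sub>C x k) = u *\<^sub>C (\<Sum>k\<in>G. a k *\<^sub>C x k)"
      by (simp add: scaleC_sum_right scaleC_scaleC)
    finally show ?thesis by (simp add: norm_scaleC u mult.commute)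
  qed
  have "\<delta> / 2 * cmod (a n) \<le> norm (\<Sum>k\<in>G. a k *\<^sub>C x k)"
    if G: "finite G" "G \<subseteq> M" and n: "n \<in> G" for a G n
  proof -
    have "Max ((\<lambda>k. cmod (a k)) ` G) \<in> (\<lambda>k. cmod (a k)) ` G"
      using G n by (intro Max_in) auto
    then obtain j where "j \<in> G" "Max ((\<lambda>k. cmod (a k)) ` G) = cmod (a j)" by blast
    moreover have "cmod (a k) \<le> Max ((\<lambda>k. cmod (a k)) ` G)" if "k \<in> G" for k
      using G(1) that by simp
    ultimately have j: "j \<in> G" "\<And>k. k \<in> G \<Longrightarrow> cmod (a k) \<le> cmod (a j)" by simp_all
    have "\<delta> / 2 * cmod (a n) \<le> \<delta> / 2 * cmod (a j)"
      using j(2)[OF n] \<delta>(2) by (simp add: mult_left_mono)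
    also have "\<dots> \<le> norm (\<Sum>k\<in>G. a k *\<^sub>C x k)" using G j by (intro max) auto
    finally show ?thesis .
  qed
  then show ?thesis by (rule that[OF M(1)])
qed

lemma c0_iff: "f \<in> c0 \<longleftrightarrow> apply_bcontfun f \<longlonglongrightarrow> 0"
  by (simp add: c0_def)

lemma c0_closed_under:
  shows "0 \<in> c0" and "f \<in> c0 \<Longrightarrow> g \<in> c0 \<Longrightarrow> f + g \<in> c0" and "f \<in> c0 \<Longrightarrow> c *\<^sub>C f \<in> c0"
    and "f \<in> c0 \<Longrightarrow> g \<in> c0 \<Longrightarrow> f - g \<in> c0"
proof -
  show "0 \<in> c0" by (simp add: c0_iff)
  show "f + g \<in> c0" if "f \<in> c0" "g \<in> c0"
    using tendsto_add[of "apply_bcontfun f" 0 sequentially "apply_bcontfun g" 0] that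
    by (simp add: c0_iff)
  show "f - g \<in> c0" if "f \<in> c0" "g \<in> c0"
    using tendsto_diff[of "apply_bcontfun f" 0 sequentially "apply_bcontfun g" 0] that
    by (simp add: c0_iff)
  show "c *\<^sub>C f \<in> c0" if "f \<in> c0"
    using tendsto_mult_left[of "apply_bcontfun f" 0 sequentially c] that
    by (simp add: c0_iff apply_bcontfun_scaleC[abs_def] scaleC_complex_def)
qed

lemma closed_c0: "closed c0"
  unfolding closed_sequential_limits
proof (intro allI impI)
  fix F :: "nat \<Rightarrow> nat \<Rightarrow>\<^sub>C complex" and g
  assume F: "(\<forall>n. F n \<in> c0) \<and> F \<longlonglongrightarrow> g"
  show "g \<in> c0"
    unfolding c0_iff
  proof (rule LIMSEQ_I)
    fix r :: real assume "r > 0"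
    then obtain n where n: "norm (F n - g) < r / 2"
      using F LIMSEQ_D[of F g "r / 2"] by (meson half_gt_zero order_refl)
    have "apply_bcontfun (F n) \<longlonglongrightarrow> 0" using F by (simp add: c0_iff)
    then obtain N where N: "\<And>k. k \<ge> N \<Longrightarrow> cmod (F n k) < r / 2"
      using LIMSEQ_D[of "apply_bcontfun (F n)" 0 "r / 2"] \<open>r > 0\<close> by auto
    have "cmod (g k - 0) < r" if "k \<ge> N" for k
    proof -
      have "cmod (g k) \<le> cmod (F n k) + cmod (F n k - g k)"
        by (metis norm_minus_commute norm_triangle_sub)
      moreover have "cmod (F n k - g k) \<le> norm (F n - g)"
        using norm_bounded[of "F n - g" k] by simp
      ultimately show ?thesis using N[OF that] n by simp
    qed
    then show "\<exists>no. \<forall>n\<ge>no. cmod (apply_bcontfun g n - 0) < r" by blast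
  qed
qed

text \<open>The uniform limit of bounded continuous functions is bounded and continuous. The domain carries
  a topology only, as \<^typ>\<open>nat\<close> does below.\<close>

lemma Cauchy_bcontfun_convergent:
  fixes F :: "nat \<Rightarrow> 'a::topological_space \<Rightarrow>\<^sub>C 'b::complete_space"
  assumes "Cauchy F"
  shows "convergent F"
proof -
  have "uniformly_Cauchy_on UNIV (\<lambda>n. apply_bcontfun (F n))"
    unfolding uniformly_Cauchy_on_def
    using metric_CauchyD[OF assms] dist_bounded by (metis (no_types, lifting) le_less_trans)
  then obtain g where "uniform_limit UNIV (\<lambda>n. apply_bcontfun (F n)) g sequentially"
    using Cauchy_uniformly_convergent uniformly_convergent_on_def by blast
  then show ?thesis
    using uniform_limit_bcontfunE[OF _ sequentially_bot] convergentI by metis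
qed

text \<open>The two estimates say that \<open>T f = \<Sum>k. f k *\<^sub>C y k\<close> is bounded above and below on \<open>c0\<close>.
  The upper one also yields convergence of the series, as the tails of a null sequence have
  small supremum; the lower one makes the image complete, hence closed, and the inverse continuous.\<close>

lemma contains_copy_of_c0I:
  fixes y :: "nat \<Rightarrow> 'a::complex_banach"
  assumes up: "\<And>a G m. finite G \<Longrightarrow> m \<ge> 0 \<Longrightarrow> (\<And>k. k \<in> G \<Longrightarrow> cmod (a k) \<le> m) \<Longrightarrow>
      norm (\<Sum>k\<in>G. a k *\<^sub>C y k) \<le> C * m"
    and low: "\<And>a G n. finite G \<Longrightarrow> n \<in> G \<Longrightarrow> c * cmod (a n) \<le> norm (\<Sum>k\<in>G. a k *\<^sub>C y k)"
    and "c > 0"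
  shows "contains_copy_of_c0 TYPE('a)"
proof -
  define T where "T f = (\<Sum>k. apply_bcontfun f k *\<^sub>C y k)" for f :: "nat \<Rightarrow>\<^sub>C complex"
  have "0 \<le> C" using up[of "{}" 1 "\<lambda>_. 0"] by simp
  have summable: "summable (\<lambda>k. apply_bcontfun f k *\<^sub>C y k)" if f: "f \<in> c0" for f
    unfolding summable_Cauchy
  proof (intro allI impI)
    fix e :: real assume "e > 0"
    define m where "m = e / (2 * (C + 1))"
    have m: "m > 0" "C * m < e"
      using \<open>e > 0\<close> \<open>0 \<le> C\<close> by (auto simp: m_def field_simps add_pos_nonneg add_strict_increasing2)
    obtain N where N: "\<And>k. k \<ge> N \<Longrightarrow> cmod (apply_bcontfun f k) < m"
      using LIMSEQ_D[OF f[unfolded c0_iff] m(1)] by auto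
    have "norm (\<Sum>k=i..<j. apply_bcontfun f k *\<^sub>C y k) < e" if "N \<le> i" for i j
    proof -
      have "norm (\<Sum>k=i..<j. apply_bcontfun f k *\<^sub>C y k) \<le> C * m"
        using N that m by (intro up) (auto intro: less_imp_le)
      then show ?thesis using m by simp
    qed
    then show "\<exists>N. \<forall>i\<ge>N. \<forall>j. norm (\<Sum>k=i..<j. apply_bcontfun f k *\<^sub>C y k) < e" by blast
  qed
  have T_lim: "(\<lambda>n. norm (\<Sum>k<n. apply_bcontfun f k *\<^sub>C y k)) \<longlonglongrightarrow> norm (T f)" if "f \<in> c0" for f
    unfolding T_def by (intro tendsto_norm summable_LIMSEQ summable that)
  have T_le: "norm (T f) \<le> C * norm f" if "f \<in> c0" for f
    by (rule LIMSEQ_le_const2[OF T_lim[OF that]]) (auto intro!: up norm_bounded)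
  have T_ge: "c * norm f \<le> norm (T f)" if "f \<in> c0" for f
  proof -
    have "c * cmod (apply_bcontfun f n) \<le> norm (T f)" for n
      by (rule LIMSEQ_le_const[OF T_lim[OF that]])
        (use low[of "{..<_}" n "apply_bcontfun f"] in \<open>auto intro!: exI[of _ "Suc n"]\<close>)
    then have "norm f \<le> norm (T f) / c"
      using \<open>c > 0\<close> by (intro norm_bound) (simp add: field_simps)
    then show ?thesis using \<open>c > 0\<close> by (simp add: field_simps)
  qed
  have T_add: "T (f + g) = T f + T g" if "f \<in> c0" "g \<in> c0" for f g
    using suminf_add[OF summable[OF that(1)] summable[OF that(2)]]
    by (simp add: T_def scaleC_add_left)
  have T_diff: "T (f - g) = T f - T g" if "f \<in> c0" "g \<in> c0" for f g
    using suminf_diff[OF summable[OF that(1)] summable[OF that(2)]]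
    by (simp add: T_def complex_module_simps)
  have T_scale: "T (b *\<^sub>C f) = b *\<^sub>C T f" if "f \<in> c0" for f b
    using bounded_linear.suminf[OF bounded_linear_scaleC summable[OF that], of b]
    by (simp add: T_def apply_bcontfun_scaleC scaleC_complex_def scaleC_scaleC)
  have dist_le: "dist (T f) (T g) \<le> C * dist f g" if "f \<in> c0" "g \<in> c0" for f g
    using T_le[of "f - g"] that by (simp add: dist_norm T_diff c0_closed_under)
  have dist_ge: "dist f g \<le> 1 / c * dist (T f) (T g)" if "f \<in> c0" "g \<in> c0" for f g
    using T_ge[of "f - g"] that \<open>c > 0\<close>
    by (simp add: dist_norm T_diff c0_closed_under field_simps)
  have inj: "inj_on T c0"
    using dist_ge by (fastforce intro!: inj_onI)
  define R where "R = inv_into c0 T"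
  have RT: "R (T f) = f" if "f \<in> c0" for f
    unfolding R_def by (rule inv_into_f_f[OF inj that])
  have cont_T: "continuous_on c0 T"
    by (rule lipschitz_on_continuous_on[OF lipschitz_onI[of c0 T C]]) (auto intro: dist_le \<open>0 \<le> C\<close>)
  have "homeomorphism (T ` c0) c0 R T"
  proof (rule homeomorphismI)
    show "continuous_on (T ` c0) R"
      by (rule lipschitz_on_continuous_on[OF lipschitz_onI[of _ _ "1 / c"]])
        (use \<open>c > 0\<close> dist_ge in \<open>auto simp: RT\<close>)
  qed (use RT cont_T in auto)
  moreover have "clinear_on (T ` c0) R"
    by (auto simp: clinear_on_def RT c0_closed_under T_add[symmetric] T_scale[symmetric])
  moreover have "csubspace (T ` c0)"
    unfolding module.subspace_def[OF module_scaleC]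
  proof (intro conjI ballI allI)
    have "T 0 = 0" by (simp add: T_def complex_module_simps)
    then show "0 \<in> T ` c0" by (metis c0_closed_under(1) image_eqI)
  qed (auto simp: T_add[symmetric] T_scale[symmetric] c0_closed_under)
  moreover have "closed (T ` c0)"
    unfolding closed_sequential_limits
  proof (intro allI impI)
    fix z l assume z: "(\<forall>n. z n \<in> T ` c0) \<and> z \<longlonglongrightarrow> l"
    then have "\<forall>n. \<exists>f. f \<in> c0 \<and> z n = T f" by auto
    then obtain F where F: "\<And>n. F n \<in> c0" "\<And>n. z n = T (F n)" by metis
    have "Cauchy z" using z LIMSEQ_imp_Cauchy by blast
    have "Cauchy F"
    proof (rule metric_CauchyI)
      fix e :: real assume "e > 0"
      then obtain N where "\<And>m n. m \<ge> N \<Longrightarrow> n \<ge> N \<Longrightarrow> dist (z m) (z n) < c * e"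
        using metric_CauchyD[OF \<open>Cauchy z\<close>, of "c * e"] \<open>c > 0\<close> by auto
      then have "1 / c * dist (z m) (z n) < e" if "m \<ge> N" "n \<ge> N" for m n
        using that \<open>c > 0\<close> by (simp add: field_simps)
      moreover have "dist (F m) (F n) \<le> 1 / c * dist (z m) (z n)" for m n
        using dist_ge F by simp
      ultimately have "dist (F m) (F n) < e" if "m \<ge> N" "n \<ge> N" for m n
        using that le_less_trans by blast
      then show "\<exists>M. \<forall>m\<ge>M. \<forall>n\<ge>M. dist (F m) (F n) < e" by blast
    qed
    then obtain g where g: "F \<longlonglongrightarrow> g" using Cauchy_bcontfun_convergent convergent_def by metis
    then have "g \<in> c0" using F closed_c0 closed_sequentially by blast
    then have "(\<lambda>n. T (F n)) \<longlonglongrightarrow> T g"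
      using cont_T F g by (auto simp: continuous_on_sequentially o_def)
    moreover have "z = (\<lambda>n. T (F n))"
      using F(2) by (rule ext)
    ultimately have "l = T g" using z LIMSEQ_unique by blast
    then show "l \<in> T ` c0" using \<open>g \<in> c0\<close> by blast
  qed
  ultimately show ?thesis
    unfolding contains_copy_of_c0_def linearly_homeomorphic_def by blast
qed

text \<open>The selection principle of Bessaga and Pelczynski: a sequence with bounded finite
  subset sums whose terms stay away from zero has a subsequence that is equivalent to
  the unit vector basis of \<open>c0\<close>.\<close>

theorem bessaga_pelczynski:
  fixes x :: "nat \<Rightarrow> 'a::complex_banach"
  assumes B: "\<And>G. finite G \<Longrightarrow> norm (\<Sum>k\<in>G. x k) \<le> B"
    and \<delta>: "\<And>n. \<delta> \<le> norm (x n)" "\<delta> > 0"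
  shows "contains_copy_of_c0 TYPE('a)"
proof -
  obtain M where M: "infinite M" and low: "\<And>a G n. finite G \<Longrightarrow> G \<subseteq> M \<Longrightarrow> n \<in> G \<Longrightarrow>
      \<delta> / 2 * cmod (a n) \<le> norm (\<Sum>k\<in>G. a k *\<^sub>C x k)"
    using exists_subsequence_c0_lower_bound[OF B \<delta>] by metis
  define r where "r = enumerate M"
  have r: "inj r" "range r \<subseteq> M"
    using M strict_mono_enumerate[OF M] enumerate_in_set[OF M]
    by (auto simp: r_def strict_mono_imp_inj_on)
  have reindex: "(\<Sum>k\<in>G. a k *\<^sub>C x (r k)) = (\<Sum>k\<in>r ` G. a (inv_into UNIV r k) *\<^sub>C x k)" for a G
    using r(1) by (simp add: sum.reindex inj_on_subset)
  show ?thesis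
  proof (rule contains_copy_of_c0I)
    show "norm (\<Sum>k\<in>G. a k *\<^sub>C x (r k)) \<le> (4 * B) * m"
      if "finite G" "m \<ge> 0" "\<And>k. k \<in> G \<Longrightarrow> cmod (a k) \<le> m" for a G m
      unfolding reindex by (rule norm_sum_scaleC_le[OF B]) (use that r in auto)
    show "\<delta> / 2 * cmod (a n) \<le> norm (\<Sum>k\<in>G. a k *\<^sub>C x (r k))" if "finite G" "n \<in> G" for a G n
      using low[of "r ` G" "r n" "\<lambda>k. a (inv_into UNIV r k)"] that r unfolding reindex by auto
  qed (use \<delta> in simp)
qed

section \<open>Almost additive sets\<close>

text \<open>Choose the vectors one after the other, each almost additive with respect to the finitely many
  members of \<open>U\<close> that approximate the earlier subset sums. With error \<open>2\<^sup>-\<^sup>n\<close> at stage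
  \<open>n\<close>, every finite subset sum stays within distance 2 of the bounded set \<open>U\<close>.\<close>

lemma contains_copy_of_c0_if_almost_additive:
  fixes U :: "'a::complex_banach set"
  assumes "0 \<in> U" and bound: "\<And>u. u \<in> U \<Longrightarrow> norm u \<le> B" and "\<delta> > 0"
    and step: "\<And>F \<eta>. finite F \<Longrightarrow> F \<subseteq> U \<Longrightarrow> \<eta> > 0 \<Longrightarrow>
      \<exists>v. \<delta> \<le> norm v \<and> (\<forall>w\<in>F. \<exists>w'\<in>U. norm (v + w - w') \<le> \<eta>)"
  shows "contains_copy_of_c0 TYPE('a)"
proof -
  \<comment> \<open>One stage of the construction: \<open>F\<close> holds approximants of the subset sums so far,
    \<open>v\<close> is the new vector and \<open>F'\<close> the enlarged set of approximants.\<close>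
  define next_ok where "next_ok n F v F' \<longleftrightarrow> F \<subseteq> F' \<and> \<delta> \<le> norm v \<and>
      (\<forall>w\<in>F. \<exists>w'\<in>F'. norm (v + w - w') \<le> (1 / 2) ^ n)" for n :: nat and F F' :: "'a set" and v
  have "\<exists>F. \<forall>n. (finite (F n) \<and> F n \<subseteq> U \<and> 0 \<in> F n) \<and> (\<exists>v. next_ok n (F n) v (F (Suc n)))"
  proof (rule dependent_nat_choice)
    show "\<exists>F. finite F \<and> F \<subseteq> U \<and> 0 \<in> F"
      using \<open>0 \<in> U\<close> by (intro exI[of _ "{0}"]) auto
  next
    fix F and n :: nat assume F: "finite F \<and> F \<subseteq> U \<and> 0 \<in> F"
    then obtain v where v: "\<delta> \<le> norm v" "\<forall>w\<in>F. \<exists>w'\<in>U. norm (v + w - w') \<le> (1 / 2) ^ n"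
      using step[of F "(1 / 2) ^ n"] by auto
    then obtain s where s: "\<And>w. w \<in> F \<Longrightarrow> s w \<in> U \<and> norm (v + w - s w) \<le> (1 / 2) ^ n"
      by metis
    show "\<exists>F'. (finite F' \<and> F' \<subseteq> U \<and> 0 \<in> F') \<and> (\<exists>v. next_ok n F v F')"
      unfolding next_ok_def using F v s by (intro exI[of _ "F \<union> s ` F"] conjI exI[of _ v]) auto
  qed
  then obtain F v where F: "\<And>n. F n \<subseteq> U" "\<And>n. 0 \<in> F n"
      and next_ok: "\<And>n. next_ok n (F n) (v n) (F (Suc n))"
    by metis
  have approx: "\<exists>w\<in>F n. norm ((\<Sum>i\<in>G. v i) - w) \<le> (\<Sum>i<n. (1 / 2) ^ i)"
    if "G \<subseteq> {..<n}" for n G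
    using that
  proof (induction n arbitrary: G)
    case 0
    then show ?case using F(2)[of 0] by auto
  next
    case (Suc n)
    let ?H = "G \<inter> {..<n}"
    obtain w where w: "w \<in> F n" "norm ((\<Sum>i\<in>?H. v i) - w) \<le> (\<Sum>i<n. (1 / 2) ^ i)"
      using Suc.IH[of ?H] by auto
    show ?case
    proof (cases "n \<in> G")
      case True
      then have G: "G = insert n ?H" using Suc.prems by (auto simp: less_Suc_eq)
      obtain w' where w': "w' \<in> F (Suc n)" "norm (v n + w - w') \<le> (1 / 2) ^ n"
        using next_ok[of n] w(1) by (auto simp: next_ok_def)
      have eq: "(\<Sum>i\<in>G. v i) - w' = ((\<Sum>i\<in>?H. v i) - w) + (v n + w - w')"
        by (subst G) simp
      have "norm ((\<Sum>i\<in>G. v i) - w') \<le> (\<Sum>i<Suc n. (1 / 2) ^ i)"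
        unfolding eq sum.lessThan_Suc
        using norm_triangle_ineq[of "(\<Sum>i\<in>?H. v i) - w" "v n + w - w'"] w(2) w'(2) by linarith
      then show ?thesis using w'(1) by blast
    next
      case False
      then have "G = ?H" using Suc.prems by (auto simp: less_Suc_eq)
      then have "norm ((\<Sum>i\<in>G. v i) - w) \<le> (\<Sum>i<Suc n. (1 / 2) ^ i)"
        using w(2) by (simp add: add_increasing2)
      then show ?thesis using w(1) next_ok[of n] by (auto simp: next_ok_def)
    qed
  qed
  have geometric: "(\<Sum>i<n. (1 / 2 :: real) ^ i) \<le> 2" for n
    by (simp add: geometric_sum)
  show ?thesis
  proof (rule bessaga_pelczynski)
    show "norm (\<Sum>i\<in>G. v i) \<le> B + 2" if "finite G" for G
    proof -
      obtain n where "G \<subseteq> {..<n}" using finite_nat_bounded[OF \<open>finite G\<close>] by blast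
      then obtain w where w: "w \<in> F n" "norm ((\<Sum>i\<in>G. v i) - w) \<le> 2"
        using approx geometric order_trans by meson
      have "norm (\<Sum>i\<in>G. v i) \<le> norm w + norm ((\<Sum>i\<in>G. v i) - w)"
        by (rule norm_triangle_sub)
      moreover have "norm w \<le> B" using bound F(1) w(1) by blast
      ultimately show ?thesis using w(2) by simp
    qed
    show "\<delta> \<le> norm (v n)" for n using next_ok[of n] by (simp add: next_ok_def)
  qed (rule \<open>\<delta> > 0\<close>)
qed

section \<open>Relative compactness and strong closures\<close>

lemma relatively_compact_if_subset_compact:
  fixes A :: "'a::t2_space set"
  assumes "A \<subseteq> K" and "compact K"
  shows "relatively_compact A"
proof -
  have "closure A \<subseteq> K" using assms by (simp add: closure_minimal compact_imp_closed)
  then have "closure A = K \<inter> closure A" by blast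
  then show ?thesis
    unfolding relatively_compact_def using assms(2) closed_closure compact_Int_closed by metis
qed

lemma relatively_compact_subset:
  fixes A :: "'a::t2_space set"
  assumes "A \<subseteq> B" and "relatively_compact B"
  shows "relatively_compact A"
  using assms closure_subset[of B] unfolding relatively_compact_def[of B]
  by (intro relatively_compact_if_subset_compact[of A "closure B"]) auto

lemma relatively_compact_iff_totally_bounded:
  fixes A :: "'a::complete_space set"
  shows "relatively_compact A \<longleftrightarrow> (\<forall>e>0. \<exists>k. finite k \<and> A \<subseteq> (\<Union>a\<in>k. ball a e))"
proof
  assume "relatively_compact A"
  then show "\<forall>e>0. \<exists>k. finite k \<and> A \<subseteq> (\<Union>a\<in>k. ball a e)"
    unfolding relatively_compact_def compact_eq_totally_bounded by (meson closure_subset order_trans)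
next
  assume tb: "\<forall>e>0. \<exists>k. finite k \<and> A \<subseteq> (\<Union>a\<in>k. ball a e)"
  have "\<exists>k. finite k \<and> closure A \<subseteq> (\<Union>a\<in>k. ball a e)" if "e > 0" for e
  proof -
    obtain k where k: "finite k" "A \<subseteq> (\<Union>a\<in>k. ball a (e / 2))"
      using tb \<open>e > 0\<close> half_gt_zero by meson
    then have "closure A \<subseteq> (\<Union>a\<in>k. cball a (e / 2))"
      by (intro closure_minimal closed_UN) force+
    also have "\<dots> \<subseteq> (\<Union>a\<in>k. ball a e)" using \<open>e > 0\<close> by force
    finally show ?thesis using k(1) by blast
  qed
  then show "relatively_compact A"
    by (simp add: relatively_compact_def compact_eq_totally_bounded complete_eq_closed)
qed

lemma relatively_compact_minus:
  fixes a b :: "'i \<Rightarrow> 'a::real_normed_vector"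
  assumes "relatively_compact (a ` I)" and "relatively_compact (b ` I)"
  shows "relatively_compact ((\<lambda>i. a i - b i) ` I)"
proof (rule relatively_compact_if_subset_compact)
  show "compact {u - v | u v. u \<in> closure (a ` I) \<and> v \<in> closure (b ` I)}"
    using assms by (intro compact_differences) (simp_all add: relatively_compact_def)
  have "a ` I \<subseteq> closure (a ` I)" "b ` I \<subseteq> closure (b ` I)" by (rule closure_subset)+
  then show "(\<lambda>i. a i - b i) ` I \<subseteq> {u - v | u v. u \<in> closure (a ` I) \<and> v \<in> closure (b ` I)}"
    by blast
qed

text \<open>A basic neighbourhood in the topology of pointwise convergence constrains finitely many
  points only.\<close>

lemma strong_closure_approx:
  assumes T: "T \<in> strong_operator_topology_on V closure_of \<R>"
    and F: "finite F" "F \<subseteq> V" and "\<eta> > 0"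
  obtains S where "S \<in> \<R>" and "\<And>y. y \<in> F \<Longrightarrow> norm (T y - S y) < \<eta>"
proof -
  let ?X = "strong_operator_topology_on V"
  let ?N = "\<lambda>F. {f \<in> topspace ?X. \<forall>y\<in>F. f y \<in> ball (T y) \<eta>}"
  have "openin ?X (?N F)"
    using F
  proof (induction F rule: finite_induct)
    case empty
    then show ?case by simp
  next
    case (insert y F)
    have "continuous_map ?X euclidean (\<lambda>f. f y)"
      unfolding strong_operator_topology_on_def using insert.prems
      by (intro continuous_map_from_subtopology continuous_map_product_projection) auto
    then have "openin ?X {f \<in> topspace ?X. f y \<in> ball (T y) \<eta>}"
      by (rule openin_continuous_map_preimage) simp
    moreover have "?N (insert y F) = {f \<in> topspace ?X. f y \<in> ball (T y) \<eta>} \<inter> ?N F"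
      by auto
    ultimately show ?case using insert by (metis (no_types, lifting) insert_subset openin_Int)
  qed
  moreover have "T \<in> ?N F" using T \<open>\<eta> > 0\<close> by (simp add: in_closure_of)
  moreover have "\<forall>N. T \<in> N \<and> openin ?X N \<longrightarrow> (\<exists>S. S \<in> \<R> \<and> S \<in> N)"
    by (rule T[unfolded in_closure_of, THEN conjunct2])
  ultimately have "\<exists>S. S \<in> \<R> \<and> S \<in> ?N F" by (elim allE[of _ "?N F"]) simp
  then obtain S where "S \<in> \<R>" "S \<in> ?N F" by (elim exE conjE)
  then show ?thesis by (intro that[of S]) (auto simp: dist_norm)
qed

section \<open>Almost periodic and reversible vectors\<close>

locale jdlg_semigroup =
  fixes \<S> :: "('a::complex_banach \<Rightarrow>\<^sub>L 'a) set" and P :: "'a \<Rightarrow> 'a"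
  assumes semigroup: "operator_semigroup \<S>"
    and abelian: "abelian \<S>"
    and bounded: "bounded \<S>"
    and JdLG: "JdLG_projection \<S> P"
begin

abbreviation E :: "'a set" where "E \<equiv> E_aap \<S>"

abbreviation E_rev :: "'a set" where "E_rev \<equiv> P ` E"

lemma comp_closed: "S \<in> \<S> \<Longrightarrow> T \<in> \<S> \<Longrightarrow> S o\<^sub>L T \<in> \<S>"
  using semigroup by (simp add: operator_semigroup_def)

lemma commute: "S \<in> \<S> \<Longrightarrow> T \<in> \<S> \<Longrightarrow> S (T y) = T (S y)"
  using abelian unfolding abelian_def by (metis blinfun_apply_blinfun_compose)

text \<open>A bound that is at least 1 may be divided by.\<close>

lemma bound_exists: "\<exists>M\<ge>1. \<forall>S\<in>\<S>. \<forall>y. norm (S y) \<le> M * norm y"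
proof -
  obtain M where M: "\<And>S. S \<in> \<S> \<Longrightarrow> norm S \<le> M" using bounded by (auto simp: bounded_iff)
  have "norm (S y) \<le> max 1 M * norm y" if "S \<in> \<S>" for S y
    by (rule order_trans[OF norm_blinfun mult_right_mono]) (use M[OF that] in auto)
  then show ?thesis by (intro exI[of _ "max 1 M"]) auto
qed

definition M :: real where "M = (SOME M. M \<ge> 1 \<and> (\<forall>S\<in>\<S>. \<forall>y. norm (S y) \<le> M * norm y))"

lemma M_ge_1: "M \<ge> 1" and norm_le: "S \<in> \<S> \<Longrightarrow> norm (S y) \<le> M * norm y"
  using someI_ex[OF bound_exists] unfolding M_def by auto

lemma E_iff: "y \<in> E \<longleftrightarrow> relatively_compact ((\<lambda>S. blinfun_apply S y) ` \<S>)"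
  by (simp add: E_aap_def setcompr_eq_image)

lemma E_minus:
  assumes "y \<in> E" and "z \<in> E"
  shows "y - z \<in> E"
  using relatively_compact_minus[of "\<lambda>S. blinfun_apply S y" \<S> "\<lambda>S. blinfun_apply S z"] assms
  by (simp add: E_iff blinfun.diff_right)

lemma E_invariant:
  assumes "y \<in> E" and "S \<in> \<S>"
  shows "S y \<in> E"
proof -
  have "R (S y) \<in> (\<lambda>S. blinfun_apply S y) ` \<S>" if "R \<in> \<S>" for R
    by (rule image_eqI[OF _ comp_closed[OF that assms(2)]]) simp
  then have "(\<lambda>R. blinfun_apply R (S y)) ` \<S> \<subseteq> (\<lambda>S. blinfun_apply S y) ` \<S>" by blast
  with assms(1) show ?thesis
    unfolding E_iff by (elim relatively_compact_subset)
qed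

lemma closure_orbit_subset_E:
  assumes "y \<in> E"
  shows "closure ((\<lambda>S. blinfun_apply S y) ` \<S>) \<subseteq> E"
proof
  let ?O = "(\<lambda>S. blinfun_apply S y) ` \<S>"
  fix z assume z: "z \<in> closure ?O"
  have "R z \<in> closure ?O" if "R \<in> \<S>" for R
  proof -
    have "R (S y) \<in> ?O" if "S \<in> \<S>" for S
      by (rule image_eqI[OF _ comp_closed[OF \<open>R \<in> \<S>\<close> that]]) simp
    then have "R ` ?O \<subseteq> closure ?O" using closure_subset[of ?O] by blast
    then have "R ` closure ?O \<subseteq> closure ?O"
      by (intro image_closure_subset) (auto intro: linear_continuous_on blinfun.bounded_linear_right)
    then show ?thesis using z by blast
  qed
  then have "(\<lambda>R. blinfun_apply R z) ` \<S> \<subseteq> closure ?O" by blast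
  moreover have "compact (closure ?O)"
    using assms by (simp add: E_iff relatively_compact_def)
  ultimately show "z \<in> E"
    unfolding E_iff by (rule relatively_compact_if_subset_compact)
qed

lemma zero_in_E: "0 \<in> E"
  using semigroup unfolding E_iff operator_semigroup_def relatively_compact_def
  by (simp add: image_constant_conv)

lemma E_uminus: "y \<in> E \<Longrightarrow> - y \<in> E"
  using E_minus[OF zero_in_E] by simp

lemma E_add: "y \<in> E \<Longrightarrow> z \<in> E \<Longrightarrow> y + z \<in> E"
  using E_minus[of y "- z"] E_uminus by simp

abbreviation \<T> :: "('a \<Rightarrow> 'a) set" where "\<T> \<equiv> strong_closure_aap \<S>"

lemma closure_approx:
  assumes "T \<in> \<T>" and "finite F" and "F \<subseteq> E" and "\<eta> > 0"
  obtains S where "S \<in> \<S>" and "\<And>y. y \<in> F \<Longrightarrow> norm (T y - S y) < \<eta>"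
proof -
  obtain f where f: "f \<in> restrict_ops (blinfun_apply ` \<S>) E" "\<And>y. y \<in> F \<Longrightarrow> norm (T y - f y) < \<eta>"
    using strong_closure_approx[OF assms(1)[unfolded strong_closure_aap_def] assms(2-4)] by metis
  then obtain S where S: "S \<in> \<S>" "f = restrict S E" by (auto simp: restrict_ops_def)
  have "norm (T y - S y) < \<eta>" if "y \<in> F" for y
    using f(2)[OF that] subsetD[OF assms(3) that] S(2) by simp
  with S(1) show ?thesis by (rule that)
qed

lemma restrict_in_closure:
  assumes "S \<in> \<S>"
  shows "restrict S E \<in> \<T>"
proof -
  have "restrict R E \<in> topspace (strong_operator_topology_on E)" if R: "R \<in> \<S>" for R
  proof -
    have "clinear_on UNIV R"
      using semigroup R by (simp add: operator_semigroup_def)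
    moreover have "c *\<^sub>C y \<in> E" if "y \<in> E" for c y
    proof -
      have "(\<lambda>S. blinfun_apply S (c *\<^sub>C y)) ` \<S> = (\<lambda>S. c *\<^sub>C blinfun_apply S y) ` \<S>"
        using semigroup by (intro image_cong) (auto simp: operator_semigroup_def clinear_on_def)
      also have "\<dots> \<subseteq> (\<lambda>z. c *\<^sub>C z) ` closure ((\<lambda>S. blinfun_apply S y) ` \<S>)"
        using closure_subset[of "(\<lambda>S. blinfun_apply S y) ` \<S>"] by blast
      finally show ?thesis
        unfolding E_iff
      proof (rule relatively_compact_if_subset_compact)
        show "compact ((\<lambda>z. c *\<^sub>C z) ` closure ((\<lambda>S. blinfun_apply S y) ` \<S>))"
          using that unfolding E_iff relatively_compact_def
          by (intro compact_continuous_image bounded_linear.continuous_on[OF bounded_linear_scaleC])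
            auto
      qed
    qed
    ultimately have "clinear_on E (restrict R E)"
      by (auto simp: clinear_on_def E_add)
    moreover have "\<forall>y\<in>E. norm (restrict R E y) \<le> M * norm y" using norm_le[OF R] by simp
    ultimately show ?thesis
      using E_invariant[OF _ R]
      by (auto simp: strong_operator_topology_on_def bounded_ops_on_def)
  qed
  then have "restrict_ops (blinfun_apply ` \<S>) E \<subseteq> topspace (strong_operator_topology_on E)"
    by (auto simp: restrict_ops_def)
  from closure_of_subset[OF this] show ?thesis
    unfolding strong_closure_aap_def using assms by (auto simp: restrict_ops_def)
qed

lemma closure_ops: "T \<in> \<T> \<Longrightarrow> T \<in> bounded_ops_on E"
  by (auto simp: strong_closure_aap_def in_closure_of strong_operator_topology_on_def)

lemma closure_maps: "T \<in> \<T> \<Longrightarrow> y \<in> E \<Longrightarrow> T y \<in> E"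
  using closure_ops by (auto simp: bounded_ops_on_def)

lemma closure_add: "T \<in> \<T> \<Longrightarrow> y \<in> E \<Longrightarrow> z \<in> E \<Longrightarrow> T (y + z) = T y + T z"
  using closure_ops by (auto simp: bounded_ops_on_def clinear_on_def)

lemma closure_minus:
  assumes "T \<in> \<T>" and "y \<in> E" and "z \<in> E"
  shows "T (y - z) = T y - T z"
  using closure_add[OF assms(1) E_minus[OF assms(2,3)] assms(3)] by simp

text \<open>Pointwise limits of operators commuting with \<open>S\<close> commute with \<open>S\<close>; continuity of \<open>S\<close> enters
  through the bound \<open>M\<close>.\<close>

lemma closure_commute:
  assumes T: "T \<in> \<T>" and S: "S \<in> \<S>" and y: "y \<in> E"
  shows "T (S y) = S (T y)"
proof -
  have "norm (T (S y) - S (T y)) \<le> e" if "e > 0" for e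
  proof -
    define \<eta> where "\<eta> = e / (2 * M)"
    have \<eta>: "\<eta> > 0" "\<eta> \<le> e / 2" "M * \<eta> = e / 2"
      using M_ge_1 \<open>e > 0\<close> by (auto simp: \<eta>_def field_simps)
    obtain V where V: "V \<in> \<S>" "\<And>z. z \<in> {S y, y} \<Longrightarrow> norm (T z - V z) < \<eta>"
      using closure_approx[OF T, of "{S y, y}" \<eta>] y E_invariant[OF y S] \<eta>(1) by auto
    have "norm (S (V y) - S (T y)) \<le> M * norm (V y - T y)"
      using norm_le[OF S, of "V y - T y"] by (simp add: blinfun.diff_right)
    also have "\<dots> \<le> M * \<eta>"
      using V(2)[of y] M_ge_1 by (intro mult_left_mono) (auto simp: norm_minus_commute)
    finally have "norm (S (V y) - S (T y)) \<le> e / 2" using \<eta>(3) by simp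
    moreover have "norm (T (S y) - S (V y)) \<le> e / 2"
      using V(2)[of "S y"] \<eta>(2) commute[OF V(1) S] by simp
    ultimately show ?thesis
      using norm_triangle_ineq[of "T (S y) - S (V y)" "S (V y) - S (T y)"] by simp
  qed
  then have "norm (T (S y) - S (T y)) \<le> 0" by (rule field_le_epsilon) simp
  then show ?thesis by simp
qed

lemma P_in_closure: "P \<in> \<T>"
  using JdLG by (simp add: JdLG_projection_def Let_def)

lemma E_rev_subset: "E_rev \<subseteq> E"
  using closure_maps[OF P_in_closure] by blast

lemma E_rev_invariant:
  assumes "y \<in> E_rev" and "S \<in> \<S>"
  shows "S y \<in> E_rev"
proof -
  obtain z where z: "z \<in> E" "y = P z" using assms(1) by blast
  then have "S y = P (S z)" using closure_commute[OF P_in_closure assms(2)] by simp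
  then show ?thesis using E_invariant[OF z(1) assms(2)] by simp
qed

lemma E_rev_minus:
  assumes "y \<in> E_rev" and "z \<in> E_rev"
  shows "y - z \<in> E_rev"
proof -
  obtain a b where ab: "a \<in> E" "b \<in> E" "y = P a" "z = P b" using assms by blast
  then have "y - z = P (a - b)" using closure_minus[OF P_in_closure] by simp
  then show ?thesis using E_minus[OF ab(1,2)] by simp
qed

lemma zero_in_E_rev: "0 \<in> E_rev"
  using E_rev_minus[OF imageI[OF zero_in_E] imageI[OF zero_in_E]] by simp

text \<open>In the group on \<open>E_rev\<close>, the inverse of \<open>S\<close> is a strong
  limit of semigroup elements, so finitely many vectors moved by \<open>S\<close> can be moved back nearly to
  their places by some \<open>V\<close> in the semigroup itself.\<close>

lemma recurrence:
  assumes S: "S \<in> \<S>" and F: "finite F" "F \<subseteq> E_rev" and "\<eta> > 0"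
  obtains V where "V \<in> \<S>" and "\<And>y. y \<in> F \<Longrightarrow> norm (V (S y) - y) < \<eta>"
proof -
  let ?G = "ops_monoid \<T> E_rev"
  interpret group ?G
    using JdLG by (simp add: JdLG_projection_def Let_def topological_group_def)
  have "restrict S E_rev = restrict (restrict S E) E_rev"
    using E_rev_subset by (auto simp: restrict_def fun_eq_iff)
  then have "restrict S E_rev \<in> carrier ?G"
    unfolding ops_monoid_def restrict_ops_def partial_object.select_convs
    by (rule image_eqI[OF _ restrict_in_closure[OF S]])
  then have "\<exists>R\<in>carrier ?G. R \<otimes>\<^bsub>?G\<^esub> restrict S E_rev = \<one>\<^bsub>?G\<^esub>"
    using l_inv_ex by blast
  then obtain T where T: "T \<in> \<T>"
      and eq: "compose E_rev (restrict T E_rev) (restrict S E_rev) = (\<lambda>y\<in>E_rev. y)"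
    by (auto simp: ops_monoid_def restrict_ops_def)
  have inverse: "T (S y) = y" if "y \<in> E_rev" for y
    using fun_cong[OF eq, of y] that E_rev_invariant[OF that S] by (simp add: compose_def)
  have "S ` F \<subseteq> E" using F(2) E_rev_invariant[OF _ S] E_rev_subset by blast
  then obtain V where V: "V \<in> \<S>" "\<And>z. z \<in> S ` F \<Longrightarrow> norm (T z - V z) < \<eta>"
    using closure_approx[OF T, of "S ` F" \<eta>] F(1) \<open>\<eta> > 0\<close> by auto
  have "norm (V (S y) - y) < \<eta>" if "y \<in> F" for y
    using V(2)[of "S y"] inverse[of y] that F(2) by (auto simp: norm_minus_commute)
  with V(1) show ?thesis by (rule that)
qed

text \<open>Undo \<open>V\<close> approximately by a semigroup element, whose norm is at most \<open>M\<close>.\<close>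

lemma norm_lower_bound_on_E_rev:
  assumes V: "V \<in> \<S>" and y: "y \<in> E_rev"
  shows "norm y \<le> M * norm (V y)"
proof (rule field_le_epsilon)
  fix e :: real assume "e > 0"
  then obtain W where W: "W \<in> \<S>" "norm (W (V y) - y) < e"
    using recurrence[OF V, of "{y}" e] y by auto
  have "norm y \<le> norm (W (V y)) + norm (W (V y) - y)"
    by (metis norm_minus_commute norm_triangle_sub)
  then show "norm y \<le> M * norm (V y) + e"
    using norm_le[OF W(1), of "V y"] W(2) by simp
qed

text \<open>Pigeonhole for finitely many almost periodic vectors: \<open>\<kappa> S\<close> records, for each \<open>y\<close> in
  \<open>F\<close>, a nearby point of a finite net of the orbit of \<open>y\<close>.\<close>

lemma finite_partition_by_action:
  assumes F: "finite F" "F \<subseteq> E" and "\<eta> > 0"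
  obtains \<kappa> :: "('a \<Rightarrow>\<^sub>L 'a) \<Rightarrow> 'a \<Rightarrow> 'a" where "finite (\<kappa> ` \<S>)"
    and "\<And>S S' y. S \<in> \<S> \<Longrightarrow> S' \<in> \<S> \<Longrightarrow> \<kappa> S = \<kappa> S' \<Longrightarrow> y \<in> F \<Longrightarrow> norm (S y - S' y) < \<eta>"
proof -
  have "\<exists>K. finite K \<and> (\<lambda>S. blinfun_apply S y) ` \<S> \<subseteq> (\<Union>a\<in>K. ball a (\<eta> / 2))" if "y \<in> F" for y
  proof -
    have "relatively_compact ((\<lambda>S. blinfun_apply S y) ` \<S>)"
      using that F(2) by (auto simp flip: E_iff)
    then show ?thesis
      using half_gt_zero[OF \<open>\<eta> > 0\<close>] unfolding relatively_compact_iff_totally_bounded by blast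
  qed
  then obtain K where K: "\<And>y. y \<in> F \<Longrightarrow> finite (K y)"
      "\<And>y. y \<in> F \<Longrightarrow> (\<lambda>S. blinfun_apply S y) ` \<S> \<subseteq> (\<Union>a\<in>K y. ball a (\<eta> / 2))"
    by metis
  have "\<forall>S\<in>\<S>. \<forall>y\<in>F. \<exists>a\<in>K y. dist a (S y) < \<eta> / 2"
    using K(2) by fastforce
  then obtain k where k: "\<And>S y. S \<in> \<S> \<Longrightarrow> y \<in> F \<Longrightarrow> k S y \<in> K y \<and> dist (k S y) (S y) < \<eta> / 2"
    by metis
  show ?thesis
  proof (rule that[of "\<lambda>S. restrict (k S) F"])
    have "(\<lambda>S. restrict (k S) F) ` \<S> \<subseteq> PiE F K" using k by auto
    then show "finite ((\<lambda>S. restrict (k S) F) ` \<S>)"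
      by (rule finite_subset) (intro finite_PiE F(1) K(1))
    fix S S' y assume S: "S \<in> \<S>" "S' \<in> \<S>" and eq: "restrict (k S) F = restrict (k S') F" and y: "y \<in> F"
    have "k S y = k S' y" using fun_cong[OF eq, of y] y by simp
    then have "dist (S y) (S' y) < \<eta> / 2 + \<eta> / 2"
      using k[OF S(1) y] k[OF S(2) y] by (metis dist_commute dist_triangle_less_add)
    then show "norm (S y - S' y) < \<eta>" by (simp add: dist_norm)
  qed
qed

section \<open>Compactness of cocycles and orbits\<close>

text \<open>The elements \<open>u S = P (x - S x)\<close> form a bounded cocycle with values in \<open>E_rev\<close>. If they are
  not totally bounded, then there are \<open>S\<close> and \<open>S'\<close> that act almost equally on any prescribed
  finite set \<open>F\<close> while \<open>u S\<close> and \<open>u S'\<close> are a fixed distance apart. Multiplying both with an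
  approximate inverse \<open>V\<close> of \<open>S\<close> gives two operators that almost fix \<open>F\<close>, and one of them
  has a large cocycle value. If \<open>R\<close> almost fixes \<open>u Q\<close>, the cocycle identity reads
  \<open>u (R Q) = u R + R (u Q)\<close>, which is nearly \<open>u R + u Q\<close>. Hence the values of \<open>u\<close> are an
  almost additive set and produce a copy of \<open>c0\<close>.\<close>

lemma relatively_compact_projected_differences:
  assumes no_c0: "\<not> contains_copy_of_c0 TYPE('a)"
    and x: "\<And>T. T \<in> \<S> \<Longrightarrow> x - T x \<in> E"
  shows "relatively_compact ((\<lambda>S. P (x - blinfun_apply S x)) ` \<S>)"
proof (rule ccontr)
  define u where "u S = P (x - blinfun_apply S x)" for S
  assume "\<not> relatively_compact ((\<lambda>S. P (x - blinfun_apply S x)) ` \<S>)"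
  then obtain e where "e > 0" and e: "\<And>k. finite k \<Longrightarrow> \<not> u ` \<S> \<subseteq> (\<Union>a\<in>k. ball a e)"
    unfolding relatively_compact_iff_totally_bounded u_def by blast
  have u_rev: "u S \<in> E_rev" if "S \<in> \<S>" for S
    using x[OF that] by (simp add: u_def)
  have cocycle: "u (V o\<^sub>L S) = u V + V (u S)" if "V \<in> \<S>" "S \<in> \<S>" for V S
  proof -
    have "u (V o\<^sub>L S) = P ((x - V x) + V (x - S x))"
      by (simp add: u_def blinfun.diff_right)
    also have "\<dots> = u V + V (u S)"
      using closure_add[OF P_in_closure x[OF that(1)] E_invariant[OF x[OF that(2)] that(1)]]
        closure_commute[OF P_in_closure that(1) x[OF that(2)]]
      by (simp add: u_def)
    finally show ?thesis .
  qed
  \<comment> \<open>Otherwise one representative from each of finitely many classes would give a finite net.\<close>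
  have separated: "\<exists>S\<in>\<S>. \<exists>S'\<in>\<S>. e \<le> norm (u S - u S') \<and> (\<forall>y\<in>F. norm (S y - S' y) < \<eta>)"
    if F: "finite F" "F \<subseteq> E" and "\<eta> > 0" for F \<eta>
  proof (rule ccontr)
    assume contra: "\<not> ?thesis"
    obtain \<kappa> :: "('a \<Rightarrow>\<^sub>L 'a) \<Rightarrow> 'a \<Rightarrow> 'a" where \<kappa>: "finite (\<kappa> ` \<S>)"
      "\<And>S S' y. S \<in> \<S> \<Longrightarrow> S' \<in> \<S> \<Longrightarrow> \<kappa> S = \<kappa> S' \<Longrightarrow> y \<in> F \<Longrightarrow> norm (S y - S' y) < \<eta>"
      using finite_partition_by_action[OF F \<open>\<eta> > 0\<close>] by metis
    define r where "r = inv_into \<S> \<kappa>"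
    have r: "r (\<kappa> S) \<in> \<S>" "\<kappa> (r (\<kappa> S)) = \<kappa> S" if "S \<in> \<S>" for S
      using that by (auto simp: r_def inv_into_into f_inv_into_f)
    have "norm (u (r (\<kappa> S)) - u S) < e" if "S \<in> \<S>" for S
      using contra r[OF that] that \<kappa>(2) by (meson not_le)
    then have "u ` \<S> \<subseteq> (\<Union>a\<in>u ` r ` \<kappa> ` \<S>. ball a e)"
      by (fastforce simp: dist_norm)
    with e[of "u ` r ` \<kappa> ` \<S>"] \<kappa>(1) show False by simp
  qed
  obtain K where K: "\<And>y. y \<in> E \<Longrightarrow> norm (P y) \<le> K * norm y"
    using closure_ops[OF P_in_closure] by (auto simp: bounded_ops_on_def)
  have "contains_copy_of_c0 TYPE('a)"
  proof (rule contains_copy_of_c0_if_almost_additive)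
    show "0 \<in> insert 0 (u ` \<S>)" by simp
    show "e / (2 * M) > 0" using \<open>e > 0\<close> M_ge_1 by simp
  next
    fix v assume "v \<in> insert 0 (u ` \<S>)"
    then consider "v = 0" | S where "S \<in> \<S>" "v = u S" by blast
    then show "norm v \<le> \<bar>K\<bar> * (norm x + M * norm x)"
    proof cases
      case 1
      then show ?thesis using M_ge_1 by simp
    next
      case 2
      have "norm v \<le> K * norm (x - S x)" unfolding 2 u_def by (rule K[OF x[OF 2(1)]])
      also have "\<dots> \<le> \<bar>K\<bar> * norm (x - S x)" by (intro mult_right_mono) auto
      also have "norm (x - S x) \<le> norm x + M * norm x"
        using norm_triangle_ineq4[of x "S x"] norm_le[OF 2(1), of x] by simp
      finally show ?thesis by (simp add: mult_left_mono)
    qed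
  next
    fix F :: "'a set" and \<eta> :: real
    assume F: "finite F" "F \<subseteq> insert 0 (u ` \<S>)" and "\<eta> > 0"
    have F_rev: "F \<subseteq> E_rev" using F(2) u_rev zero_in_E_rev by blast
    have "\<eta> / (2 * M) > 0" using \<open>\<eta> > 0\<close> M_ge_1 by simp
    then obtain S S' where S: "S \<in> \<S>" and S': "S' \<in> \<S>" and sep: "e \<le> norm (u S - u S')"
        and close: "\<And>y. y \<in> F \<Longrightarrow> norm (S y - S' y) < \<eta> / (2 * M)"
      using separated[of F "\<eta> / (2 * M)"] F(1) F_rev E_rev_subset by blast
    obtain V where V: "V \<in> \<S>" "\<And>y. y \<in> F \<Longrightarrow> norm (V (S y) - y) < \<eta> / 2"
      using recurrence[OF S F(1) F_rev, of "\<eta> / 2"] \<open>\<eta> > 0\<close> by auto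
    have nearly_fixed: "norm (V (S y) - y) \<le> \<eta>" "norm (V (S' y) - y) \<le> \<eta>" if "y \<in> F" for y
    proof -
      show "norm (V (S y) - y) \<le> \<eta>" using V(2)[OF that] \<open>\<eta> > 0\<close> by simp
      have "norm (V (S' y) - V (S y)) \<le> M * norm (S y - S' y)"
        using norm_le[OF V(1), of "S' y - S y"] by (simp add: blinfun.diff_right norm_minus_commute)
      also have "\<dots> \<le> M * (\<eta> / (2 * M))"
        using close[OF that] M_ge_1 by (intro mult_left_mono) auto
      also have "\<dots> = \<eta> / 2" using M_ge_1 by simp
      finally show "norm (V (S' y) - y) \<le> \<eta>"
        using V(2)[OF that] norm_triangle_ineq[of "V (S' y) - V (S y)" "V (S y) - y"] by simp
    qed
    have "e \<le> M * norm (V (u S - u S'))"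
      using norm_lower_bound_on_E_rev[OF V(1) E_rev_minus[OF u_rev[OF S] u_rev[OF S']]] sep by simp
    also have "V (u S - u S') = u (V o\<^sub>L S) - u (V o\<^sub>L S')"
      by (simp add: cocycle V(1) S S' blinfun.diff_right)
    finally have "e / M \<le> norm (u (V o\<^sub>L S) - u (V o\<^sub>L S'))"
      using M_ge_1 by (simp add: field_simps)
    also have "\<dots> \<le> norm (u (V o\<^sub>L S)) + norm (u (V o\<^sub>L S'))"
      by (rule norm_triangle_ineq4)
    finally have "e / (2 * M) \<le> norm (u (V o\<^sub>L S)) \<or> e / (2 * M) \<le> norm (u (V o\<^sub>L S'))"
      using M_ge_1 by (auto simp: field_simps)
    then obtain R where R: "R \<in> \<S>" "e / (2 * M) \<le> norm (u R)"
        and fix_R: "\<And>y. y \<in> F \<Longrightarrow> norm (R y - y) \<le> \<eta>"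
      using nearly_fixed comp_closed[OF V(1) S] comp_closed[OF V(1) S']
      by (metis blinfun_apply_blinfun_compose)
    show "\<exists>v. e / (2 * M) \<le> norm v \<and> (\<forall>w\<in>F. \<exists>w'\<in>insert 0 (u ` \<S>). norm (v + w - w') \<le> \<eta>)"
    proof (intro exI[of _ "u R"] conjI ballI)
      fix w assume w: "w \<in> F"
      with F(2) consider "w = 0" | Q where "Q \<in> \<S>" "w = u Q" by blast
      then show "\<exists>w'\<in>insert 0 (u ` \<S>). norm (u R + w - w') \<le> \<eta>"
      proof cases
        case 1
        then show ?thesis using R(1) \<open>\<eta> > 0\<close> by (intro bexI[of _ "u R"]) auto
      next
        case 2
        have eq: "u R + w - u (R o\<^sub>L Q) = w - R w" using cocycle[OF R(1) 2(1)] 2(2) by simp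
        have "norm (u R + w - u (R o\<^sub>L Q)) \<le> \<eta>"
          unfolding eq using fix_R[OF w] by (simp add: norm_minus_commute)
        then show ?thesis using comp_closed[OF R(1) 2(1)] by blast
      qed
    qed (rule R(2))
  qed
  with no_c0 show False by blast
qed

text \<open>From right to left, \<open>S x = x - P (x - S x) - (I - P) (x - S x)\<close> splits the orbit into pieces that
  are relatively compact, by the absence of \<open>c0\<close> and by hypothesis respectively. From left to
  right, \<open>(I - P) (x - S x)\<close> depends continuously on \<open>S x\<close> as this varies in the closure of the
  orbit, a compact subset of \<open>E\<close>.\<close>

lemma relatively_compact_orbit_iff:
  assumes no_c0: "\<not> contains_copy_of_c0 TYPE('a)"
  shows "x \<in> E \<longleftrightarrow> (\<forall>T\<in>\<S>. x - T x \<in> E) \<and>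
    relatively_compact ((\<lambda>S. (x - blinfun_apply S x) - P (x - blinfun_apply S x)) ` \<S>)"
proof (intro iffI conjI ballI)
  assume x: "x \<in> E"
  then show "x - T x \<in> E" if "T \<in> \<S>" for T
    using E_minus E_invariant that by blast
  let ?K = "closure ((\<lambda>S. blinfun_apply S x) ` \<S>)"
  let ?f = "\<lambda>z. (x - z) - P (x - z)"
  have K: "compact ?K" "?K \<subseteq> E"
    using x closure_orbit_subset_E by (auto simp: E_iff relatively_compact_def)
  obtain B where B: "\<And>y. y \<in> E \<Longrightarrow> norm (P y) \<le> B * norm y"
    using closure_ops[OF P_in_closure] by (auto simp: bounded_ops_on_def)
  have "dist (P (x - y)) (P (x - z)) \<le> \<bar>B\<bar> * dist y z" if "y \<in> ?K" "z \<in> ?K" for y z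
  proof -
    have yz: "x - y \<in> E" "x - z \<in> E" using that K(2) x E_minus by blast+
    have "norm (P (x - y) - P (x - z)) \<le> B * norm ((x - y) - (x - z))"
      using B[OF E_minus[OF yz]] closure_minus[OF P_in_closure yz] by simp
    also have "\<dots> \<le> \<bar>B\<bar> * norm ((x - y) - (x - z))" by (intro mult_right_mono) auto
    finally show ?thesis by (simp add: dist_norm norm_minus_commute)
  qed
  then have "continuous_on ?K (\<lambda>z. P (x - z))"
    by (intro lipschitz_on_continuous_on[OF lipschitz_onI[of _ _ "\<bar>B\<bar>"]]) auto
  then have "compact (?f ` ?K)"
    using K(1) by (intro compact_continuous_image continuous_intros)
  then show "relatively_compact ((\<lambda>S. (x - blinfun_apply S x) - P (x - blinfun_apply S x)) ` \<S>)"
    using closure_subset by (elim relatively_compact_if_subset_compact[rotated]) force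
next
  assume "(\<forall>T\<in>\<S>. x - T x \<in> E) \<and>
    relatively_compact ((\<lambda>S. (x - blinfun_apply S x) - P (x - blinfun_apply S x)) ` \<S>)"
  then have x: "\<And>T. T \<in> \<S> \<Longrightarrow> x - T x \<in> E"
    and aws: "relatively_compact ((\<lambda>S. (x - blinfun_apply S x) - P (x - blinfun_apply S x)) ` \<S>)"
    by auto
  have "relatively_compact ((\<lambda>S. x) ` \<S>)"
    by (rule relatively_compact_if_subset_compact[of _ "{x}"]) auto
  from relatively_compact_minus[OF relatively_compact_minus[OF this
      relatively_compact_projected_differences[OF no_c0 x]] aws]
  show "x \<in> E" by (simp add: E_iff)
qed

end

theorem theorem3p3:
  fixes \<S> :: "('a::complex_banach \<Rightarrow>\<^sub>L 'a) set"
    and P :: "'a \<Rightarrow> 'a"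
    and x :: 'a
  assumes "\<not> contains_copy_of_c0 TYPE('a)"
    and "operator_semigroup \<S>"
    and "abelian \<S>"
    and "bounded \<S>"
    and "JdLG_projection \<S> P"
  shows "relatively_compact {blinfun_apply S x | S. S \<in> \<S>} \<longleftrightarrow>
    (\<forall>T\<in>\<S>. relatively_compact
        {blinfun_apply S x - blinfun_apply S (blinfun_apply T x) | S. S \<in> \<S>}) \<and>
    relatively_compact
        {(x - blinfun_apply S x) - P (x - blinfun_apply S x) | S. S \<in> \<S>}"
proof -
  interpret jdlg_semigroup \<S> P
    by (rule jdlg_semigroup.intro[OF assms(2-5)])
  show ?thesis
    using relatively_compact_orbit_iff[OF assms(1), of x]
    by (simp only: E_iff setcompr_eq_image Collect_mem_eq blinfun.diff_right)
qed

end
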